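(* Let $A \rtimes^{\sigma} G$ be a skew groupoid ring, where $G$ is a groupoid with $ob(G)$ finite, all $A_e$, $e \in ob(G)$, are equal integral domains (that is, all the rings $A_e$ coincide with one and the same integral domain) and each $G_e$, $e \in ob(G)$, is an abelian group. Then $A$ is maximal commutative in $A \rtimes^{\sigma} G$ if and only if every intersection of a nonzero twosided ideal of $A \rtimes^{\sigma} G$ and $A$ is nonzero (i.e. is not $\{0\}$).
   Context: Rings are associative and unital; ring homomorphisms preserve multiplicative identities. $G$ is a small category; an object is identified with its identity morphism; $s \in G$ means that $s$ is a morphism of $G$; $d(s)$ and $c(s)$ are the domain and codomain of $s$; $G^{(2)}$ is the set of pairs $(s,t)$ of morphisms with $d(s)=c(t)$ (so that $st$ is defined). A groupoid is a category in which every morphism is invertible. For $e\in ob(G)$, $G_e$ is the set of $s\in G$ with $d(s)=c(s)=e$ (a group when $G$ is a groupoid). Skew groupoid ring: $G$ is a groupoid, $A$ is the direct sum of rings $A_e$, $e\in ob(G)$, and $\sigma_s : A_{d(s)}\to A_{c(s)}$, $s\in G$, are ring homomorphisms with $\sigma_e=\mathrm{id}_{A_e}$ for $e\in ob(G)$ and $\sigma_s\circ\sigma_t=\sigma_{st}$ for $(s,t)\in G^{(2)}$. Then $A\rtimes^\sigma G$ is the set of formal sums $\sum_{s\in G}a_su_s$ with $a_s\in A_{c(s)}$, all but finitely many zero, with componentwise addition and multiplication given by biadditive extension of $(a_su_s)(b_tu_t)=a_s\sigma_s(b_t)u_{st}$ if $(s,t)\in G^{(2)}$ and $(a_su_s)(b_tu_t)=0$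 otherwise. When $ob(G)$ is finite its multiplicative identity is $\sum_{e\in ob(G)}1_{A_e}u_e$. The ring $A$ is identified with the coefficient ring $\oplus_{e\in ob(G)}A_eu_e$. The commutant of a subset of a ring is the set of all elements of the ring commuting with every element of the subset. $A$ is maximal commutative in $A\rtimes^\sigma G$ if $A$ is commutative and coincides with its commutant in $A\rtimes^\sigma G$. *)

theory Defs
  imports "HOL-Algebra.RingHom"
begin

section \<open>Small categories and groupoids\<close>

text \<open>
  Objects are identified with their identity morphisms, so the objects form a subset of the
  set of morphisms. Composition \<open>Comp G s t\<close> is meaningful only for
  \<open>s, t \<in> Mor G\<close> with \<open>Dom G s = Cod G t\<close>.
\<close>

record 'g category =
  Mor :: "'g set"
  Ob :: "'g set"
  Dom :: "'g \<Rightarrow> 'g"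
  Cod :: "'g \<Rightarrow> 'g"
  Comp :: "'g \<Rightarrow> 'g \<Rightarrow> 'g"

locale small_category =
  fixes G :: "'g category"
  assumes ob_mor: "e \<in> Ob G \<Longrightarrow> e \<in> Mor G"
    and dom_ob: "s \<in> Mor G \<Longrightarrow> Dom G s \<in> Ob G"
    and cod_ob: "s \<in> Mor G \<Longrightarrow> Cod G s \<in> Ob G"
    and ob_dom: "e \<in> Ob G \<Longrightarrow> Dom G e = e"
    and ob_cod: "e \<in> Ob G \<Longrightarrow> Cod G e = e"
    and comp_mor: "\<lbrakk>s \<in> Mor G; t \<in> Mor G; Dom G s = Cod G t\<rbrakk> \<Longrightarrow> Comp G s t \<in> Mor G"
    and dom_comp: "\<lbrakk>s \<in> Mor G; t \<in> Mor G; Dom G s = Cod G t\<rbrakk> \<Longrightarrow> Dom G (Comp G s t) = Dom G t"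
    and cod_comp: "\<lbrakk>s \<in> Mor G; t \<in> Mor G; Dom G s = Cod G t\<rbrakk> \<Longrightarrow> Cod G (Comp G s t) = Cod G s"
    and comp_dom: "s \<in> Mor G \<Longrightarrow> Comp G s (Dom G s) = s"
    and comp_cod: "s \<in> Mor G \<Longrightarrow> Comp G (Cod G s) s = s"
    and comp_assoc: "\<lbrakk>s \<in> Mor G; t \<in> Mor G; r \<in> Mor G; Dom G s = Cod G t; Dom G t = Cod G r\<rbrakk>
      \<Longrightarrow> Comp G (Comp G s t) r = Comp G s (Comp G t r)"

locale groupoid = small_category +
  assumes invertible: "s \<in> Mor G \<Longrightarrow>
    \<exists>t\<in>Mor G. Dom G t = Cod G s \<and> Cod G t = Dom G s \<and>
      Comp G t s = Dom G s \<and> Comp G s t = Cod G s"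

definition isotropy :: "'g category \<Rightarrow> 'g \<Rightarrow> 'g monoid" where
  "isotropy G e = \<lparr>carrier = {s \<in> Mor G. Dom G s = e \<and> Cod G s = e}, mult = Comp G, one = e\<rparr>"

section \<open>Skew groupoid rings\<close>

locale skew_groupoid_system = groupoid G for G :: "'g category" +
  fixes A :: "'g \<Rightarrow> ('a, 'm) ring_scheme" and \<sigma> :: "'g \<Rightarrow> 'a \<Rightarrow> 'a"
  assumes ring_A: "e \<in> Ob G \<Longrightarrow> ring (A e)"
    and sigma_hom: "s \<in> Mor G \<Longrightarrow> \<sigma> s \<in> ring_hom (A (Dom G s)) (A (Cod G s))"
    and sigma_id: "\<lbrakk>e \<in> Ob G; a \<in> carrier (A e)\<rbrakk> \<Longrightarrow> \<sigma> e a = a"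
    and sigma_comp: "\<lbrakk>s \<in> Mor G; t \<in> Mor G; Dom G s = Cod G t; a \<in> carrier (A (Dom G t))\<rbrakk>
      \<Longrightarrow> \<sigma> s (\<sigma> t a) = \<sigma> (Comp G s t) a"

definition skew_support :: "'g category \<Rightarrow> ('g \<Rightarrow> ('a, 'm) ring_scheme) \<Rightarrow> ('g \<Rightarrow> 'a) \<Rightarrow> 'g set" where
  "skew_support G A x = {s \<in> Mor G. x s \<noteq> \<zero>\<^bsub>A (Cod G s)\<^esub>}"

text \<open>
  The formal sum \<open>\<Sum> a\<^sub>s u\<^sub>s\<close> is the function \<open>s \<mapsto> a\<^sub>s\<close>, set to \<open>undefined\<close> outside the
  morphisms. The coefficient of \<open>u\<^sub>r\<close> in a product collects
  all \<open>a\<^sub>s \<sigma>\<^sub>s(b\<^sub>t)\<close> with \<open>s\<close>, \<open>t\<close> composable and \<open>st = r\<close>. The unit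
  \<open>\<Sum> 1 u\<^sub>e\<close> lies in the carrier only if there are finitely many objects.
\<close>

definition skew_ring ::
  "'g category \<Rightarrow> ('g \<Rightarrow> ('a, 'm) ring_scheme) \<Rightarrow> ('g \<Rightarrow> 'a \<Rightarrow> 'a) \<Rightarrow> ('g \<Rightarrow> 'a) ring" where
  "skew_ring G A \<sigma> =
    \<lparr>carrier = {x \<in> (\<Pi>\<^sub>E s\<in>Mor G. carrier (A (Cod G s))). finite (skew_support G A x)},
     mult = (\<lambda>x y. \<lambda>r\<in>Mor G.
       \<Oplus>\<^bsub>A (Cod G r)\<^esub> p \<in> {(s, t). s \<in> skew_support G A x \<and> t \<in> skew_support G A y \<and>
                                   Dom G s = Cod G t \<and> Comp G s t = r}.
         x (fst p) \<otimes>\<^bsub>A (Cod G r)\<^esub> \<sigma> (fst p) (y (snd p))),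
     one = (\<lambda>s\<in>Mor G. if s \<in> Ob G then \<one>\<^bsub>A (Cod G s)\<^esub> else \<zero>\<^bsub>A (Cod G s)\<^esub>),
     zero = (\<lambda>s\<in>Mor G. \<zero>\<^bsub>A (Cod G s)\<^esub>),
     add = (\<lambda>x y. \<lambda>s\<in>Mor G. x s \<oplus>\<^bsub>A (Cod G s)\<^esub> y s)\<rparr>"

text \<open>The copy \<open>\<Oplus> A\<^sub>e u\<^sub>e\<close> of \<open>A\<close> inside the skew groupoid ring.\<close>

definition coefficient_ring ::
  "'g category \<Rightarrow> ('g \<Rightarrow> ('a, 'm) ring_scheme) \<Rightarrow> ('g \<Rightarrow> 'a \<Rightarrow> 'a) \<Rightarrow> ('g \<Rightarrow> 'a) set" where
  "coefficient_ring G A \<sigma> = {x \<in> carrier (skew_ring G A \<sigma>). skew_support G A x \<subseteq> Ob G}"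

definition commutant :: "('r, 'm) ring_scheme \<Rightarrow> 'r set \<Rightarrow> 'r set" where
  "commutant R S = {x \<in> carrier R. \<forall>y\<in>S. x \<otimes>\<^bsub>R\<^esub> y = y \<otimes>\<^bsub>R\<^esub> x}"

definition maximal_commutative :: "('r, 'm) ring_scheme \<Rightarrow> 'r set \<Rightarrow> bool" where
  "maximal_commutative R S \<longleftrightarrow>
    (\<forall>x\<in>S. \<forall>y\<in>S. x \<otimes>\<^bsub>R\<^esub> y = y \<otimes>\<^bsub>R\<^esub> x) \<and> commutant R S = S"

section \<open>The skew groupoid ring is a ring\<close>

text \<open>This ensures that the two-sided ideals of \<open>skew_ring G A \<sigma>\<close> are not vacuous: the library's
  \<open>ideal I R\<close> includes the assumption that \<open>R\<close> is a ring.\<close>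

lemma (in abelian_monoid) finsum_Sigma:
  assumes "finite I" and "\<And>i. i \<in> I \<Longrightarrow> finite (B i)"
    and "\<And>i j. i \<in> I \<Longrightarrow> j \<in> B i \<Longrightarrow> f i j \<in> carrier G"
  shows "(\<Oplus>i\<in>I. \<Oplus>j\<in>B i. f i j) = (\<Oplus>p\<in>Sigma I B. f (fst p) (snd p))"
proof -
  have "(\<Oplus>p\<in>(\<Union>i\<in>I. Pair i ` B i). f (fst p) (snd p))
      = (\<Oplus>i\<in>I. \<Oplus>p\<in>Pair i ` B i. f (fst p) (snd p))"
    by (rule add.finprod_UN_disjoint) (use assms in \<open>auto simp: pairwise_def disjnt_def\<close>)
  also have "\<dots> = (\<Oplus>i\<in>I. \<Oplus>j\<in>B i. f i j)"
  proof (rule finsum_cong')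
    fix i assume "i \<in> I"
    then show "(\<Oplus>p\<in>Pair i ` B i. f (fst p) (snd p)) = (\<Oplus>j\<in>B i. f i j)"
      using assms by (subst finsum_reindex) (auto simp: inj_on_def)
  qed (use assms in auto)
  also have "(\<Union>i\<in>I. Pair i ` B i) = Sigma I B" by auto
  finally show ?thesis by simp
qed

lemma (in ring) ring_hom_finsum:
  assumes "ring S" "h \<in> ring_hom R S" "finite I" "f \<in> I \<rightarrow> carrier R"
  shows "h (\<Oplus>i\<in>I. f i) = (\<Oplus>\<^bsub>S\<^esub>i\<in>I. h (f i))"
proof -
  interpret S: ring S by fact
  interpret ring_hom_ring R S h
    by (rule ring_hom_ringI2) (use assms ring_axioms in auto)
  show ?thesis using assms(3,4)
    by (induction I) (auto simp: Pi_def)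
qed

context skew_groupoid_system
begin

lemma ring_cod: "s \<in> Mor G \<Longrightarrow> ring (A (Cod G s))"
  by (simp add: cod_ob ring_A)

lemma sigma_ring_hom: "s \<in> Mor G \<Longrightarrow> ring_hom_ring (A (Dom G s)) (A (Cod G s)) (\<sigma> s)"
  by (simp add: cod_ob dom_ob ring_A ring_hom_ringI2 sigma_hom)

lemma skew_carrier_closed:
  "x \<in> carrier (skew_ring G A \<sigma>) \<Longrightarrow> s \<in> Mor G \<Longrightarrow> x s \<in> carrier (A (Cod G s))"
  by (auto simp: skew_ring_def)

lemma skew_support_finite: "x \<in> carrier (skew_ring G A \<sigma>) \<Longrightarrow> finite (skew_support G A x)"
  by (auto simp: skew_ring_def)

lemma skew_eqI:
  assumes "x \<in> carrier (skew_ring G A \<sigma>)" "y \<in> carrier (skew_ring G A \<sigma>)"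
    "\<And>s. s \<in> Mor G \<Longrightarrow> x s = y s"
  shows "x = y"
  using assms by (auto simp: skew_ring_def intro: PiE_ext)

lemma skew_carrierI:
  assumes "x \<in> extensional (Mor G)" "\<And>s. s \<in> Mor G \<Longrightarrow> x s \<in> carrier (A (Cod G s))"
    "finite S" "\<And>s. s \<in> Mor G \<Longrightarrow> s \<notin> S \<Longrightarrow> x s = \<zero>\<^bsub>A (Cod G s)\<^esub>"
  shows "x \<in> carrier (skew_ring G A \<sigma>)"
proof -
  have "skew_support G A x \<subseteq> S" using assms(4) by (auto simp: skew_support_def)
  then show ?thesis using assms(1-3) finite_subset by (auto simp: skew_ring_def PiE_def)
qed

definition factorizations :: "'g set \<Rightarrow> 'g set \<Rightarrow> 'g \<Rightarrow> ('g \<times> 'g) set" where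
  "factorizations S T r = {(s, t). s \<in> S \<and> t \<in> T \<and> Dom G s = Cod G t \<and> Comp G s t = r}"

lemma finite_factorizations: "finite S \<Longrightarrow> finite T \<Longrightarrow> finite (factorizations S T r)"
  by (rule finite_subset[of _ "S \<times> T"]) (auto simp: factorizations_def)

lemma skew_term_closed:
  assumes "x \<in> carrier (skew_ring G A \<sigma>)" "y \<in> carrier (skew_ring G A \<sigma>)"
    "s \<in> Mor G" "t \<in> Mor G" "Dom G s = Cod G t"
  shows "\<sigma> s (y t) \<in> carrier (A (Cod G s))"
    and "x s \<otimes>\<^bsub>A (Cod G s)\<^esub> \<sigma> s (y t) \<in> carrier (A (Cod G s))"
proof -
  interpret h: ring_hom_ring "A (Dom G s)" "A (Cod G s)" "\<sigma> s"
    by (rule sigma_ring_hom) fact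
  show "\<sigma> s (y t) \<in> carrier (A (Cod G s))"
    using assms skew_carrier_closed by (metis h.hom_closed)
  then show "x s \<otimes>\<^bsub>A (Cod G s)\<^esub> \<sigma> s (y t) \<in> carrier (A (Cod G s))"
    using assms skew_carrier_closed by (metis h.S.m_closed)
qed

lemma factorizations_cod:
  assumes "(s, t) \<in> factorizations S T r" "S \<subseteq> Mor G" "T \<subseteq> Mor G"
  shows "s \<in> Mor G" "t \<in> Mor G" "Dom G s = Cod G t" "Cod G s = Cod G r" "r = Comp G s t"
  using assms by (auto simp: factorizations_def subset_iff cod_comp)

lemma skew_mult_eq:
  assumes "x \<in> carrier (skew_ring G A \<sigma>)" "y \<in> carrier (skew_ring G A \<sigma>)" "r \<in> Mor G"
    and S: "finite S" "skew_support G A x \<subseteq> S" "S \<subseteq> Mor G"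
    and T: "finite T" "skew_support G A y \<subseteq> T" "T \<subseteq> Mor G"
  shows "(x \<otimes>\<^bsub>skew_ring G A \<sigma>\<^esub> y) r =
    (\<Oplus>\<^bsub>A (Cod G r)\<^esub> p \<in> factorizations S T r. x (fst p) \<otimes>\<^bsub>A (Cod G r)\<^esub> \<sigma> (fst p) (y (snd p)))"
proof -
  interpret B: ring "A (Cod G r)" by (rule ring_cod) fact
  have "(x \<otimes>\<^bsub>skew_ring G A \<sigma>\<^esub> y) r =
    (\<Oplus>\<^bsub>A (Cod G r)\<^esub> p \<in> factorizations (skew_support G A x) (skew_support G A y) r.
      x (fst p) \<otimes>\<^bsub>A (Cod G r)\<^esub> \<sigma> (fst p) (y (snd p)))"
    using assms(3) by (simp add: skew_ring_def factorizations_def)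
  also have "\<dots> = (\<Oplus>\<^bsub>A (Cod G r)\<^esub> p \<in> factorizations S T r.
      x (fst p) \<otimes>\<^bsub>A (Cod G r)\<^esub> \<sigma> (fst p) (y (snd p)))"
  proof (rule B.add.finprod_mono_neutral_cong_left)
    show "finite (factorizations S T r)" using S T by (simp add: finite_factorizations)
    show "factorizations (skew_support G A x) (skew_support G A y) r \<subseteq> factorizations S T r"
      using S T by (auto simp: factorizations_def)
    show "(\<lambda>p. x (fst p) \<otimes>\<^bsub>A (Cod G r)\<^esub> \<sigma> (fst p) (y (snd p)))
      \<in> factorizations S T r \<rightarrow> carrier (A (Cod G r))"
    proof clarsimp
      fix s t assume "(s, t) \<in> factorizations S T r"
      note st = factorizations_cod[OF this S(3) T(3)]
      show "x s \<otimes>\<^bsub>A (Cod G r)\<^esub> \<sigma> s (y t) \<in> carrier (A (Cod G r))"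
        using skew_term_closed(2)[OF assms(1,2) st(1-3)] st(4) by simp
    qed
    fix p assume p: "p \<in> factorizations S T r -
      factorizations (skew_support G A x) (skew_support G A y) r"
    obtain s t where [simp]: "p = (s, t)" by (cases p)
    have st: "(s, t) \<in> factorizations S T r" using p by simp
    note st = factorizations_cod[OF this S(3) T(3)]
    interpret h: ring_hom_ring "A (Dom G s)" "A (Cod G s)" "\<sigma> s"
      by (rule sigma_ring_hom) (rule st)
    have "x s = \<zero>\<^bsub>A (Cod G s)\<^esub> \<or> y t = \<zero>\<^bsub>A (Cod G t)\<^esub>"
      using p st by (auto simp: factorizations_def skew_support_def)
    then show "x (fst p) \<otimes>\<^bsub>A (Cod G r)\<^esub> \<sigma> (fst p) (y (snd p)) = \<zero>\<^bsub>A (Cod G r)\<^esub>"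
    proof
      assume "x s = \<zero>\<^bsub>A (Cod G s)\<^esub>"
      then show ?thesis using skew_term_closed(1)[OF assms(1,2) st(1-3)] st(4) by simp
    next
      assume "y t = \<zero>\<^bsub>A (Cod G t)\<^esub>"
      then have "\<sigma> s (y t) = \<zero>\<^bsub>A (Cod G r)\<^esub>" using h.hom_zero st by simp
      then show ?thesis using skew_carrier_closed[OF assms(1) st(1)] st(4) by simp
    qed
  qed auto
  finally show ?thesis .
qed

lemma skew_mult_closed:
  assumes "x \<in> carrier (skew_ring G A \<sigma>)" "y \<in> carrier (skew_ring G A \<sigma>)"
  shows "x \<otimes>\<^bsub>skew_ring G A \<sigma>\<^esub> y \<in> carrier (skew_ring G A \<sigma>)"
proof -
  let ?S = "skew_support G A x" and ?T = "skew_support G A y"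
  have fin: "finite ?S" "finite ?T" using assms skew_support_finite by auto
  have sub: "?S \<subseteq> Mor G" "?T \<subseteq> Mor G" by (auto simp: skew_support_def)
  show ?thesis
  proof (rule skew_carrierI[where S = "(\<lambda>(s, t). Comp G s t) ` (?S \<times> ?T)"])
    show "x \<otimes>\<^bsub>skew_ring G A \<sigma>\<^esub> y \<in> extensional (Mor G)" by (simp add: skew_ring_def)
    show "finite ((\<lambda>(s, t). Comp G s t) ` (?S \<times> ?T))" using fin by simp
    fix r assume r: "r \<in> Mor G"
    interpret B: ring "A (Cod G r)" by (rule ring_cod) fact
    note eq = skew_mult_eq[OF assms r fin(1) order.refl sub(1) fin(2) order.refl sub(2)]
    show "(x \<otimes>\<^bsub>skew_ring G A \<sigma>\<^esub> y) r \<in> carrier (A (Cod G r))"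
      unfolding eq
    proof (rule B.finsum_closed, clarsimp)
      fix s t assume "(s, t) \<in> factorizations ?S ?T r"
      note st = factorizations_cod[OF this sub]
      show "x s \<otimes>\<^bsub>A (Cod G r)\<^esub> \<sigma> s (y t) \<in> carrier (A (Cod G r))"
        using skew_term_closed(2)[OF assms st(1-3)] st(4) by simp
    qed
    assume "r \<notin> (\<lambda>(s, t). Comp G s t) ` (?S \<times> ?T)"
    then have "factorizations ?S ?T r = {}" by (auto simp: factorizations_def)
    then show "(x \<otimes>\<^bsub>skew_ring G A \<sigma>\<^esub> y) r = \<zero>\<^bsub>A (Cod G r)\<^esub>" unfolding eq by simp
  qed
qed

lemma skew_abelian_group: "abelian_group (skew_ring G A \<sigma>)"
proof (rule abelian_groupI)
  let ?R = "skew_ring G A \<sigma>"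
  have add: "(x \<oplus>\<^bsub>?R\<^esub> y) s = x s \<oplus>\<^bsub>A (Cod G s)\<^esub> y s" if "s \<in> Mor G" for x y s
    using that by (simp add: skew_ring_def)
  have zero: "\<zero>\<^bsub>?R\<^esub> s = \<zero>\<^bsub>A (Cod G s)\<^esub>" if "s \<in> Mor G" for s
    using that by (simp add: skew_ring_def)
  have addc: "x \<oplus>\<^bsub>?R\<^esub> y \<in> carrier ?R" if x: "x \<in> carrier ?R" "y \<in> carrier ?R" for x y
  proof (rule skew_carrierI[where S = "skew_support G A x \<union> skew_support G A y"])
    show "x \<oplus>\<^bsub>?R\<^esub> y \<in> extensional (Mor G)" by (simp add: skew_ring_def)
    show "finite (skew_support G A x \<union> skew_support G A y)" using that skew_support_finite by simp
    fix s assume s: "s \<in> Mor G"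
    interpret B: ring "A (Cod G s)" by (rule ring_cod) fact
    show "(x \<oplus>\<^bsub>?R\<^esub> y) s \<in> carrier (A (Cod G s))"
      using skew_carrier_closed s x by (simp add: add)
    assume "s \<notin> skew_support G A x \<union> skew_support G A y"
    then show "(x \<oplus>\<^bsub>?R\<^esub> y) s = \<zero>\<^bsub>A (Cod G s)\<^esub>" using s by (simp add: add skew_support_def)
  qed
  have zeroc: "\<zero>\<^bsub>?R\<^esub> \<in> carrier ?R"
  proof (rule skew_carrierI[where S = "{}"])
    fix s assume s: "s \<in> Mor G"
    interpret B: ring "A (Cod G s)" by (rule ring_cod) fact
    show "\<zero>\<^bsub>?R\<^esub> s \<in> carrier (A (Cod G s))" using s by (simp add: zero)
  qed (simp_all add: zero, simp add: skew_ring_def)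
  show "\<zero>\<^bsub>?R\<^esub> \<in> carrier ?R" by (rule zeroc)
  fix x y assume x: "x \<in> carrier ?R" and y: "y \<in> carrier ?R"
  show "x \<oplus>\<^bsub>?R\<^esub> y \<in> carrier ?R" using x y by (rule addc)
  show "x \<oplus>\<^bsub>?R\<^esub> y = y \<oplus>\<^bsub>?R\<^esub> x"
  proof (rule skew_eqI)
    fix s assume s: "s \<in> Mor G"
    interpret B: ring "A (Cod G s)" by (rule ring_cod) fact
    show "(x \<oplus>\<^bsub>?R\<^esub> y) s = (y \<oplus>\<^bsub>?R\<^esub> x) s"
      using skew_carrier_closed s x y by (simp add: add B.a_comm)
  qed (use x y addc in auto)
  show "\<zero>\<^bsub>?R\<^esub> \<oplus>\<^bsub>?R\<^esub> x = x"
  proof (rule skew_eqI)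
    fix s assume s: "s \<in> Mor G"
    interpret B: ring "A (Cod G s)" by (rule ring_cod) fact
    show "(\<zero>\<^bsub>?R\<^esub> \<oplus>\<^bsub>?R\<^esub> x) s = x s" using skew_carrier_closed s x by (simp add: add zero)
  qed (use x zeroc addc in auto)
  show "\<exists>z\<in>carrier ?R. z \<oplus>\<^bsub>?R\<^esub> x = \<zero>\<^bsub>?R\<^esub>"
  proof
    let ?z = "\<lambda>s\<in>Mor G. \<ominus>\<^bsub>A (Cod G s)\<^esub> x s"
    show z: "?z \<in> carrier ?R"
    proof (rule skew_carrierI[where S = "skew_support G A x"])
      fix s assume s: "s \<in> Mor G"
      interpret B: ring "A (Cod G s)" by (rule ring_cod) fact
      show "?z s \<in> carrier (A (Cod G s))" using skew_carrier_closed s x by simp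
      assume "s \<notin> skew_support G A x"
      then show "?z s = \<zero>\<^bsub>A (Cod G s)\<^esub>" using s by (simp add: skew_support_def)
    qed (use x skew_support_finite in auto)
    show "?z \<oplus>\<^bsub>?R\<^esub> x = \<zero>\<^bsub>?R\<^esub>"
    proof (rule skew_eqI)
      fix s assume s: "s \<in> Mor G"
      interpret B: ring "A (Cod G s)" by (rule ring_cod) fact
      show "(?z \<oplus>\<^bsub>?R\<^esub> x) s = \<zero>\<^bsub>?R\<^esub> s"
        using skew_carrier_closed s x by (simp add: add zero B.l_neg)
    qed (use x z zeroc addc in auto)
  qed
  fix z assume z: "z \<in> carrier ?R"
  show "x \<oplus>\<^bsub>?R\<^esub> y \<oplus>\<^bsub>?R\<^esub> z = x \<oplus>\<^bsub>?R\<^esub> (y \<oplus>\<^bsub>?R\<^esub> z)"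
  proof (rule skew_eqI)
    fix s assume s: "s \<in> Mor G"
    interpret B: ring "A (Cod G s)" by (rule ring_cod) fact
    show "(x \<oplus>\<^bsub>?R\<^esub> y \<oplus>\<^bsub>?R\<^esub> z) s = (x \<oplus>\<^bsub>?R\<^esub> (y \<oplus>\<^bsub>?R\<^esub> z)) s"
      using skew_carrier_closed s x y z by (simp add: add B.a_assoc)
  qed (use x y z addc in auto)
qed

lemma skew_mult_assoc:
  assumes "x \<in> carrier (skew_ring G A \<sigma>)" "y \<in> carrier (skew_ring G A \<sigma>)"
    "z \<in> carrier (skew_ring G A \<sigma>)"
  shows "(x \<otimes>\<^bsub>skew_ring G A \<sigma>\<^esub> y) \<otimes>\<^bsub>skew_ring G A \<sigma>\<^esub> z
    = x \<otimes>\<^bsub>skew_ring G A \<sigma>\<^esub> (y \<otimes>\<^bsub>skew_ring G A \<sigma>\<^esub> z)"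
proof -
  let ?R = "skew_ring G A \<sigma>"
  define X Y Z where "X = skew_support G A x" and "Y = skew_support G A y"
    and "Z = skew_support G A z"
  define prods where "prods S T = {r. factorizations S T r \<noteq> {}}" for S T
  have fin: "finite X" "finite Y" "finite Z"
    using assms skew_support_finite by (auto simp: X_def Y_def Z_def)
  have sub: "X \<subseteq> Mor G" "Y \<subseteq> Mor G" "Z \<subseteq> Mor G"
    by (auto simp: skew_support_def X_def Y_def Z_def)
  have prods_fin: "finite (prods S T)" if "finite S" "finite T" for S T
  proof (rule finite_subset)
    show "prods S T \<subseteq> (\<lambda>(s, t). Comp G s t) ` (S \<times> T)"
      by (auto simp: prods_def factorizations_def)
    show "finite ((\<lambda>(s, t). Comp G s t) ` (S \<times> T))" using that by simp
  qed
  have prods_sub: "prods S T \<subseteq> Mor G" if "S \<subseteq> Mor G" "T \<subseteq> Mor G" for S T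
    using that comp_mor by (auto simp: prods_def factorizations_def)
  have supp: "skew_support G A (u \<otimes>\<^bsub>?R\<^esub> v) \<subseteq> prods (skew_support G A u) (skew_support G A v)"
    if u: "u \<in> carrier ?R" and v: "v \<in> carrier ?R" for u v
  proof
    fix r assume r: "r \<in> skew_support G A (u \<otimes>\<^bsub>?R\<^esub> v)"
    then have rm: "r \<in> Mor G" by (simp add: skew_support_def)
    interpret B: ring "A (Cod G r)" by (rule ring_cod) fact
    have "(u \<otimes>\<^bsub>?R\<^esub> v) r = \<zero>\<^bsub>A (Cod G r)\<^esub>"
      if "factorizations (skew_support G A u) (skew_support G A v) r = {}"
      using that rm by (subst skew_mult_eq[OF u v rm _ order.refl _ _ order.refl])
        (auto simp: skew_support_finite u v, auto simp: skew_support_def)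
    then show "r \<in> prods (skew_support G A u) (skew_support G A v)"
      using r by (auto simp: prods_def skew_support_def)
  qed
  note c = skew_mult_closed[OF assms(1,2)] skew_mult_closed[OF assms(2,3)]
  show ?thesis
  proof (rule skew_eqI)
    fix r assume r: "r \<in> Mor G"
    define B where "B = A (Cod G r)"
    interpret B: ring B unfolding B_def by (rule ring_cod) fact
    define Tr where "Tr = {(s, q, t). s \<in> X \<and> q \<in> Y \<and> t \<in> Z \<and> Dom G s = Cod G q \<and>
      Dom G q = Cod G t \<and> Comp G s (Comp G q t) = r}"
    define F where "F = (\<lambda>(s, q, t). x s \<otimes>\<^bsub>B\<^esub> (\<sigma> s (y q) \<otimes>\<^bsub>B\<^esub> \<sigma> s (\<sigma> q (z t))))"
    have Tr: "s \<in> Mor G" "q \<in> Mor G" "t \<in> Mor G" "Dom G s = Cod G q" "Dom G q = Cod G t"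
       "Cod G s = Cod G r" "x s \<in> carrier B" "\<sigma> s (y q) \<in> carrier B"
       "\<sigma> q (z t) \<in> carrier (A (Cod G q))" "\<sigma> s (\<sigma> q (z t)) \<in> carrier B"
       if "(s, q, t) \<in> Tr" for s q t
    proof -
      show st: "s \<in> Mor G" "q \<in> Mor G" "t \<in> Mor G" "Dom G s = Cod G q" "Dom G q = Cod G t"
        using that sub by (auto simp: Tr_def)
      show cs: "Cod G s = Cod G r"
        using that st comp_mor cod_comp unfolding Tr_def by auto
      show "x s \<in> carrier B" using skew_carrier_closed[OF assms(1) st(1)] cs by (simp add: B_def)
      show "\<sigma> s (y q) \<in> carrier B"
        using skew_term_closed(1)[OF assms(1,2) st(1,2,4)] cs by (simp add: B_def)
      show *: "\<sigma> q (z t) \<in> carrier (A (Cod G q))"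
        using skew_term_closed(1)[OF assms(2,3) st(2,3,5)] .
      interpret h: ring_hom_ring "A (Dom G s)" "A (Cod G s)" "\<sigma> s"
        by (rule sigma_ring_hom) (rule st)
      show "\<sigma> s (\<sigma> q (z t)) \<in> carrier B" using h.hom_closed * st cs by (simp add: B_def)
    qed
    have F: "F \<in> Tr \<rightarrow> carrier B" using Tr by (auto simp: F_def)
    have finTr: "finite Tr"
      by (rule finite_subset[of _ "X \<times> Y \<times> Z"]) (auto simp: Tr_def fin)
    define I where "I = factorizations (prods X Y) Z r"
    have inTrL: "(fst w, snd w, t) \<in> Tr"
      if ut: "(u, t) \<in> I" and w: "w \<in> factorizations X Y u" for u t w
    proof -
      have m: "fst w \<in> X" "snd w \<in> Y" "Dom G (fst w) = Cod G (snd w)" "u = Comp G (fst w) (snd w)"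
        using w by (auto simp: factorizations_def)
      have t: "t \<in> Z" "Dom G u = Cod G t" "r = Comp G u t"
        using ut by (auto simp: I_def factorizations_def)
      have mm: "fst w \<in> Mor G" "snd w \<in> Mor G" "t \<in> Mor G" using m t sub by auto
      have d: "Dom G (snd w) = Cod G t" using dom_comp[OF mm(1,2) m(3)] m t by simp
      show ?thesis using comp_assoc[OF mm m(3) d] m t d by (simp add: Tr_def)
    qed
    have "((x \<otimes>\<^bsub>?R\<^esub> y) \<otimes>\<^bsub>?R\<^esub> z) r =
      (\<Oplus>\<^bsub>B\<^esub> p \<in> I. (x \<otimes>\<^bsub>?R\<^esub> y) (fst p) \<otimes>\<^bsub>B\<^esub> \<sigma> (fst p) (z (snd p)))"
      unfolding B_def I_def
      by (rule skew_mult_eq[OF c(1) assms(3) r])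
        (use fin sub prods_fin prods_sub supp[OF assms(1,2)] in \<open>auto simp: X_def Y_def Z_def\<close>)
    also have "\<dots> = (\<Oplus>\<^bsub>B\<^esub> p \<in> I. \<Oplus>\<^bsub>B\<^esub> w \<in> factorizations X Y (fst p).
        F (fst w, snd w, snd p))"
    proof (rule B.finsum_cong')
      show "(\<lambda>p. \<Oplus>\<^bsub>B\<^esub> w \<in> factorizations X Y (fst p). F (fst w, snd w, snd p)) \<in> I \<rightarrow> carrier B"
      proof
        fix p assume p: "p \<in> I"
        have "(fst w, snd w, snd p) \<in> Tr" if "w \<in> factorizations X Y (fst p)" for w
          using p that inTrL[of "fst p" "snd p" w] by simp
        then show "(\<Oplus>\<^bsub>B\<^esub> w \<in> factorizations X Y (fst p). F (fst w, snd w, snd p)) \<in> carrier B"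
          using F by (intro B.finsum_closed) auto
      qed
      fix p assume p: "p \<in> I"
      obtain u t where pt [simp]: "p = (u, t)" by (cases p)
      have inTr: "(fst w, snd w, t) \<in> Tr" if "w \<in> factorizations X Y u" for w
        using p that inTrL by simp
      have ut: "u \<in> Mor G" "t \<in> Mor G" "Dom G u = Cod G t" "Cod G u = Cod G r"
        using p factorizations_cod[of u t "prods X Y" Z r] prods_sub sub by (auto simp: I_def)
      have uz: "\<sigma> u (z t) \<in> carrier B"
        using skew_term_closed(1)[OF assms(1,3) ut(1-3)] ut(4) by (simp add: B_def)
      have "(x \<otimes>\<^bsub>?R\<^esub> y) u = (\<Oplus>\<^bsub>B\<^esub> w \<in> factorizations X Y u. x (fst w) \<otimes>\<^bsub>B\<^esub> \<sigma> (fst w) (y (snd w)))"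
        using skew_mult_eq[OF assms(1,2) ut(1) fin(1) _ sub(1) fin(2) _ sub(2)] ut(4)
        by (simp add: X_def Y_def B_def)
      moreover have cl: "(\<lambda>w. x (fst w) \<otimes>\<^bsub>B\<^esub> \<sigma> (fst w) (y (snd w))) \<in> factorizations X Y u \<rightarrow> carrier B"
      proof
        fix w assume "w \<in> factorizations X Y u"
        note Tw = Tr(7,8)[OF inTr[OF this]]
        show "x (fst w) \<otimes>\<^bsub>B\<^esub> \<sigma> (fst w) (y (snd w)) \<in> carrier B" by (rule B.m_closed[OF Tw])
      qed
      ultimately have "(x \<otimes>\<^bsub>?R\<^esub> y) u \<otimes>\<^bsub>B\<^esub> \<sigma> u (z t) =
        (\<Oplus>\<^bsub>B\<^esub> w \<in> factorizations X Y u. (x (fst w) \<otimes>\<^bsub>B\<^esub> \<sigma> (fst w) (y (snd w))) \<otimes>\<^bsub>B\<^esub> \<sigma> u (z t))"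
        using B.finsum_ldistr[OF finite_factorizations[OF fin(1,2)] uz cl] by (simp only:)
      also have "\<dots> = (\<Oplus>\<^bsub>B\<^esub> w \<in> factorizations X Y u. F (fst w, snd w, t))"
      proof (rule B.finsum_cong')
        show "(\<lambda>w. F (fst w, snd w, t)) \<in> factorizations X Y u \<rightarrow> carrier B" using inTr F by auto
        fix w assume w: "w \<in> factorizations X Y u"
        note Tw = Tr[OF inTr[OF w]]
        have "u = Comp G (fst w) (snd w)" using w by (auto simp: factorizations_def)
        moreover have "z t \<in> carrier (A (Dom G (snd w)))"
          unfolding Tw(5) by (rule skew_carrier_closed[OF assms(3) Tw(3)])
        ultimately have "\<sigma> (fst w) (\<sigma> (snd w) (z t)) = \<sigma> u (z t)"
          using sigma_comp[OF Tw(1,2,4)] by (simp only:)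
        then show "(x (fst w) \<otimes>\<^bsub>B\<^esub> \<sigma> (fst w) (y (snd w))) \<otimes>\<^bsub>B\<^esub> \<sigma> u (z t) = F (fst w, snd w, t)"
          using B.m_assoc[OF Tw(7,8) uz] by (simp add: F_def)
      qed simp
      finally show "(x \<otimes>\<^bsub>?R\<^esub> y) (fst p) \<otimes>\<^bsub>B\<^esub> \<sigma> (fst p) (z (snd p)) =
        (\<Oplus>\<^bsub>B\<^esub> w \<in> factorizations X Y (fst p). F (fst w, snd w, snd p))" by simp
    qed simp
    also have "\<dots> = (\<Oplus>\<^bsub>B\<^esub> v \<in> Sigma I (\<lambda>p. factorizations X Y (fst p)).
        F (fst (snd v), snd (snd v), snd (fst v)))"
    proof (rule B.finsum_Sigma)
      show "finite I" unfolding I_def by (intro finite_factorizations prods_fin fin)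
      fix p w assume "p \<in> I" "w \<in> factorizations X Y (fst p)"
      then have "(fst w, snd w, snd p) \<in> Tr"
        using inTrL[of "fst p" "snd p" w] by simp
      then show "F (fst w, snd w, snd p) \<in> carrier B" using F by auto
    qed (simp add: finite_factorizations fin)
    also have "\<dots> = (\<Oplus>\<^bsub>B\<^esub> v \<in> Tr. F v)"
    proof -
      let ?f = "\<lambda>v. (fst (snd v), snd (snd v), snd (fst v))"
      let ?S = "Sigma I (\<lambda>p. factorizations X Y (fst p))"
      have "inj_on ?f ?S" by (auto simp: inj_on_def factorizations_def)
      moreover have im: "?f ` ?S = Tr"
      proof
        show "?f ` ?S \<subseteq> Tr" using inTrL by auto
        show "Tr \<subseteq> ?f ` ?S"
        proof
          fix v assume v: "v \<in> Tr"
          obtain s q t where [simp]: "v = (s, q, t)" by (cases v)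
          have m: "s \<in> X" "q \<in> Y" "t \<in> Z" "Dom G s = Cod G q" "Dom G q = Cod G t"
            "Comp G s (Comp G q t) = r"
            using v by (auto simp: Tr_def)
          have mm: "s \<in> Mor G" "q \<in> Mor G" "t \<in> Mor G" using m sub by auto
          have sq: "(s, q) \<in> factorizations X Y (Comp G s q)" using m by (simp add: factorizations_def)
          then have "Comp G s q \<in> prods X Y" by (auto simp: prods_def)
          then have "(Comp G s q, t) \<in> I"
            using m dom_comp[OF mm(1,2) m(4)] comp_assoc[OF mm m(4,5)]
            by (simp add: I_def factorizations_def)
          then have "((Comp G s q, t), (s, q)) \<in> ?S" using sq by simp
          then show "v \<in> ?f ` ?S" by (rule rev_image_eqI) simp
        qed
      qed
      ultimately show ?thesis using F B.finsum_reindex[of F ?f ?S] by simp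
    qed
    finally have L: "((x \<otimes>\<^bsub>?R\<^esub> y) \<otimes>\<^bsub>?R\<^esub> z) r = (\<Oplus>\<^bsub>B\<^esub> v \<in> Tr. F v)" .
    define J where "J = factorizations X (prods Y Z) r"
    have inTr: "(s, fst w, snd w) \<in> Tr" if "(s, u) \<in> J" "w \<in> factorizations Y Z u" for s u w
    proof -
      have m: "fst w \<in> Y" "snd w \<in> Z" "Dom G (fst w) = Cod G (snd w)" "u = Comp G (fst w) (snd w)"
        using that(2) by (auto simp: factorizations_def)
      have "fst w \<in> Mor G" "snd w \<in> Mor G" using m sub by auto
      then show ?thesis
        using that(1) m cod_comp by (auto simp: J_def factorizations_def Tr_def)
    qed
    have "(x \<otimes>\<^bsub>?R\<^esub> (y \<otimes>\<^bsub>?R\<^esub> z)) r =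
      (\<Oplus>\<^bsub>B\<^esub> p \<in> J. x (fst p) \<otimes>\<^bsub>B\<^esub> \<sigma> (fst p) ((y \<otimes>\<^bsub>?R\<^esub> z) (snd p)))"
      unfolding B_def J_def
      by (rule skew_mult_eq[OF assms(1) c(2) r])
        (use fin sub prods_fin prods_sub supp[OF assms(2,3)] in \<open>auto simp: X_def Y_def Z_def\<close>)
    also have "\<dots> = (\<Oplus>\<^bsub>B\<^esub> p \<in> J. \<Oplus>\<^bsub>B\<^esub> w \<in> factorizations Y Z (snd p).
        F (fst p, fst w, snd w))"
    proof (rule B.finsum_cong')
      show "(\<lambda>p. \<Oplus>\<^bsub>B\<^esub> w \<in> factorizations Y Z (snd p). F (fst p, fst w, snd w)) \<in> J \<rightarrow> carrier B"
      proof
        fix p assume p: "p \<in> J"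
        then show "(\<Oplus>\<^bsub>B\<^esub> w \<in> factorizations Y Z (snd p). F (fst p, fst w, snd w)) \<in> carrier B"
          using F inTr[of "fst p" "snd p"] by (intro B.finsum_closed) (auto simp: Pi_def)
      qed
      fix p assume p: "p \<in> J"
      obtain s u where pt [simp]: "p = (s, u)" by (cases p)
      have inTr': "(s, fst w, snd w) \<in> Tr" if "w \<in> factorizations Y Z u" for w
        using p that inTr by simp
      have su: "s \<in> Mor G" "u \<in> Mor G" "Dom G s = Cod G u" "Cod G s = Cod G r"
        using p factorizations_cod[of s u X "prods Y Z" r] prods_sub sub by (auto simp: J_def)
      have xs: "x s \<in> carrier B"
        using skew_carrier_closed[OF assms(1) su(1)] su(4) by (simp add: B_def)
      interpret h: ring_hom_ring "A (Cod G u)" B "\<sigma> s"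
        using sigma_ring_hom[OF su(1)] su(3,4) by (simp add: B_def)
      have yz: "y (fst w) \<in> carrier (A (Cod G u)) \<and> \<sigma> (fst w) (z (snd w)) \<in> carrier (A (Cod G u))"
        if w: "w \<in> factorizations Y Z u" for w
        using Tr[OF inTr'[OF w]] skew_carrier_closed[OF assms(2), of "fst w"] su(3) by simp
      have "(y \<otimes>\<^bsub>?R\<^esub> z) u = (\<Oplus>\<^bsub>A (Cod G u)\<^esub> w \<in> factorizations Y Z u.
          y (fst w) \<otimes>\<^bsub>A (Cod G u)\<^esub> \<sigma> (fst w) (z (snd w)))"
        using skew_mult_eq[OF assms(2,3) su(2) fin(2) _ sub(2) fin(3) _ sub(3)]
        by (simp add: Y_def Z_def)
      also have "\<sigma> s \<dots> = (\<Oplus>\<^bsub>B\<^esub> w \<in> factorizations Y Z u.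
          \<sigma> s (y (fst w) \<otimes>\<^bsub>A (Cod G u)\<^esub> \<sigma> (fst w) (z (snd w))))"
        by (rule h.R.ring_hom_finsum[OF B.ring_axioms h.homh])
          (use yz finite_factorizations fin in auto)
      finally have "x s \<otimes>\<^bsub>B\<^esub> \<sigma> s ((y \<otimes>\<^bsub>?R\<^esub> z) u) =
        (\<Oplus>\<^bsub>B\<^esub> w \<in> factorizations Y Z u.
          x s \<otimes>\<^bsub>B\<^esub> \<sigma> s (y (fst w) \<otimes>\<^bsub>A (Cod G u)\<^esub> \<sigma> (fst w) (z (snd w))))"
        using xs yz by (simp add: finite_factorizations fin B.finsum_rdistr)
      also have "\<dots> = (\<Oplus>\<^bsub>B\<^esub> w \<in> factorizations Y Z u. F (s, fst w, snd w))"
      proof (rule B.finsum_cong'[OF refl])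
        show "(\<lambda>w. F (s, fst w, snd w)) \<in> factorizations Y Z u \<rightarrow> carrier B" using inTr' F by auto
        fix w assume "w \<in> factorizations Y Z u"
        from yz[OF this]
        show "x s \<otimes>\<^bsub>B\<^esub> \<sigma> s (y (fst w) \<otimes>\<^bsub>A (Cod G u)\<^esub> \<sigma> (fst w) (z (snd w))) = F (s, fst w, snd w)"
          by (simp add: F_def split: prod.split)
      qed
      finally show "x (fst p) \<otimes>\<^bsub>B\<^esub> \<sigma> (fst p) ((y \<otimes>\<^bsub>?R\<^esub> z) (snd p)) =
        (\<Oplus>\<^bsub>B\<^esub> w \<in> factorizations Y Z (snd p). F (fst p, fst w, snd w))" by simp
    qed simp
    also have "\<dots> = (\<Oplus>\<^bsub>B\<^esub> v \<in> Sigma J (\<lambda>p. factorizations Y Z (snd p)).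
        F (fst (fst v), fst (snd v), snd (snd v)))"
    proof (rule B.finsum_Sigma)
      show "finite J" unfolding J_def by (intro finite_factorizations prods_fin fin)
      fix p w assume "p \<in> J" "w \<in> factorizations Y Z (snd p)"
      then have "(fst p, fst w, snd w) \<in> Tr" using inTr[of "fst p" "snd p" w] by simp
      then show "F (fst p, fst w, snd w) \<in> carrier B" using F by auto
    qed (simp add: finite_factorizations fin)
    also have "\<dots> = (\<Oplus>\<^bsub>B\<^esub> v \<in> Tr. F v)"
    proof -
      let ?f = "\<lambda>v. (fst (fst v), fst (snd v), snd (snd v))"
      let ?S = "Sigma J (\<lambda>p. factorizations Y Z (snd p))"
      have "inj_on ?f ?S" by (auto simp: inj_on_def factorizations_def)
      moreover have im: "?f ` ?S = Tr"
      proof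
        show "?f ` ?S \<subseteq> Tr" using inTr by auto
        show "Tr \<subseteq> ?f ` ?S"
        proof
          fix v assume v: "v \<in> Tr"
          obtain s q t where [simp]: "v = (s, q, t)" by (cases v)
          have m: "s \<in> X" "q \<in> Y" "t \<in> Z" "Dom G s = Cod G q" "Dom G q = Cod G t"
            "Comp G s (Comp G q t) = r"
            using v by (auto simp: Tr_def)
          have mm: "q \<in> Mor G" "t \<in> Mor G" using m sub by auto
          have qt: "(q, t) \<in> factorizations Y Z (Comp G q t)" using m by (simp add: factorizations_def)
          then have "Comp G q t \<in> prods Y Z" by (auto simp: prods_def)
          then have "(s, Comp G q t) \<in> J"
            using m cod_comp[OF mm m(5)] by (simp add: J_def factorizations_def)
          then have "((s, Comp G q t), (q, t)) \<in> ?S" using qt by simp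
          then show "v \<in> ?f ` ?S" by (rule rev_image_eqI) simp
        qed
      qed
      ultimately show ?thesis using F B.finsum_reindex[of F ?f ?S] by simp
    qed
    finally show "((x \<otimes>\<^bsub>?R\<^esub> y) \<otimes>\<^bsub>?R\<^esub> z) r = (x \<otimes>\<^bsub>?R\<^esub> (y \<otimes>\<^bsub>?R\<^esub> z)) r" using L by simp
  qed (use c assms skew_mult_closed in auto)
qed

lemma skew_ring_is_ring:
  assumes "finite (Ob G)"
  shows "ring (skew_ring G A \<sigma>)"
proof (rule ringI)
  let ?R = "skew_ring G A \<sigma>"
  interpret R: abelian_group ?R by (rule skew_abelian_group)
  have add: "(x \<oplus>\<^bsub>?R\<^esub> y) s = x s \<oplus>\<^bsub>A (Cod G s)\<^esub> y s" if "s \<in> Mor G" for x y s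
    using that by (simp add: skew_ring_def)
  have one: "\<one>\<^bsub>?R\<^esub> s = (if s \<in> Ob G then \<one>\<^bsub>A (Cod G s)\<^esub> else \<zero>\<^bsub>A (Cod G s)\<^esub>)"
    if "s \<in> Mor G" for s
    using that by (simp add: skew_ring_def)
  show "abelian_group ?R" by (rule skew_abelian_group)
  have onec: "\<one>\<^bsub>?R\<^esub> \<in> carrier ?R"
  proof (rule skew_carrierI[where S = "Ob G"])
    show "\<one>\<^bsub>?R\<^esub> \<in> extensional (Mor G)" by (simp add: skew_ring_def)
    fix s assume s: "s \<in> Mor G"
    interpret B: ring "A (Cod G s)" by (rule ring_cod) fact
    show "\<one>\<^bsub>?R\<^esub> s \<in> carrier (A (Cod G s))" using s by (simp add: one)
    assume "s \<notin> Ob G"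
    then show "\<one>\<^bsub>?R\<^esub> s = \<zero>\<^bsub>A (Cod G s)\<^esub>" using s by (simp add: one)
  qed fact
  have one_supp: "skew_support G A \<one>\<^bsub>?R\<^esub> \<subseteq> Ob G"
    by (auto simp: skew_support_def one split: if_splits)
  have ObM: "Ob G \<subseteq> Mor G" using ob_mor by auto
  have supp_sub: "skew_support G A x \<subseteq> Mor G" for x by (auto simp: skew_support_def)
  show "monoid ?R"
  proof (rule monoidI)
    show "\<one>\<^bsub>?R\<^esub> \<in> carrier ?R" by (rule onec)
    fix x assume x: "x \<in> carrier ?R"
    show "\<one>\<^bsub>?R\<^esub> \<otimes>\<^bsub>?R\<^esub> x = x"
    proof (rule skew_eqI)
      fix r assume r: "r \<in> Mor G"
      interpret B: ring "A (Cod G r)" by (rule ring_cod) fact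
      have xr: "x r \<in> carrier (A (Cod G r))" using x r by (rule skew_carrier_closed)
      have fac: "factorizations (Ob G) (insert r (skew_support G A x)) r = {(Cod G r, r)}"
        using r supp_sub[of x] by (auto simp: factorizations_def subset_iff ob_dom cod_ob comp_cod)
      have "(\<one>\<^bsub>?R\<^esub> \<otimes>\<^bsub>?R\<^esub> x) r = (\<Oplus>\<^bsub>A (Cod G r)\<^esub> p \<in> {(Cod G r, r)}.
          \<one>\<^bsub>?R\<^esub> (fst p) \<otimes>\<^bsub>A (Cod G r)\<^esub> \<sigma> (fst p) (x (snd p)))"
        using skew_mult_eq[OF onec x r assms one_supp ObM, of "insert r (skew_support G A x)"]
          skew_support_finite[OF x] supp_sub[of x] r unfolding fac by blast
      also have "\<dots> = x r"
        using xr r cod_ob[OF r] ob_mor[OF cod_ob[OF r]] ob_cod[OF cod_ob[OF r]] sigma_id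
        by (simp add: one)
      finally show "(\<one>\<^bsub>?R\<^esub> \<otimes>\<^bsub>?R\<^esub> x) r = x r" .
    qed (use x onec skew_mult_closed in auto)
    show "x \<otimes>\<^bsub>?R\<^esub> \<one>\<^bsub>?R\<^esub> = x"
    proof (rule skew_eqI)
      fix r assume r: "r \<in> Mor G"
      interpret B: ring "A (Cod G r)" by (rule ring_cod) fact
      interpret h: ring_hom_ring "A (Dom G r)" "A (Cod G r)" "\<sigma> r"
        by (rule sigma_ring_hom) fact
      have xr: "x r \<in> carrier (A (Cod G r))" using x r by (rule skew_carrier_closed)
      have fac: "factorizations (insert r (skew_support G A x)) (Ob G) r = {(r, Dom G r)}"
        using r supp_sub[of x]
        by (auto simp: factorizations_def subset_iff ob_cod dom_ob comp_dom)
      have "(x \<otimes>\<^bsub>?R\<^esub> \<one>\<^bsub>?R\<^esub>) r = (\<Oplus>\<^bsub>A (Cod G r)\<^esub> p \<in> {(r, Dom G r)}.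
          x (fst p) \<otimes>\<^bsub>A (Cod G r)\<^esub> \<sigma> (fst p) (\<one>\<^bsub>?R\<^esub> (snd p)))"
        using skew_mult_eq[OF x onec r, of "insert r (skew_support G A x)" "Ob G"]
          skew_support_finite[OF x] supp_sub[of x] r assms one_supp ObM unfolding fac by blast
      also have "\<dots> = x r"
        using xr r dom_ob[OF r] ob_mor[OF dom_ob[OF r]] ob_cod[OF dom_ob[OF r]]
        by (simp add: one)
      finally show "(x \<otimes>\<^bsub>?R\<^esub> \<one>\<^bsub>?R\<^esub>) r = x r" .
    qed (use x onec skew_mult_closed in auto)
  qed (use skew_mult_closed skew_mult_assoc in auto)
  fix x y z assume xyz: "x \<in> carrier ?R" "y \<in> carrier ?R" "z \<in> carrier ?R"
  define S where "S = skew_support G A x \<union> skew_support G A y \<union> skew_support G A z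
    \<union> skew_support G A (x \<oplus>\<^bsub>?R\<^esub> y)"
  have S: "finite S" "S \<subseteq> Mor G" "skew_support G A x \<subseteq> S" "skew_support G A y \<subseteq> S"
    "skew_support G A z \<subseteq> S" "skew_support G A (x \<oplus>\<^bsub>?R\<^esub> y) \<subseteq> S"
    using xyz supp_sub skew_support_finite by (auto simp: S_def)
  have cl: "(\<lambda>p. u (fst p) \<otimes>\<^bsub>A (Cod G r)\<^esub> \<sigma> (fst p) (v (snd p)))
      \<in> factorizations S S r \<rightarrow> carrier (A (Cod G r))"
    if "u \<in> carrier ?R" "v \<in> carrier ?R" for u v r
  proof clarsimp
    fix s t assume "(s, t) \<in> factorizations S S r"
    note st = factorizations_cod[OF this S(2) S(2)]
    show "u s \<otimes>\<^bsub>A (Cod G r)\<^esub> \<sigma> s (v t) \<in> carrier (A (Cod G r))"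
      using skew_term_closed(2)[OF that st(1-3)] st(4) by simp
  qed
  have xy: "x \<oplus>\<^bsub>?R\<^esub> y \<in> carrier ?R" using xyz by simp
  show "(x \<oplus>\<^bsub>?R\<^esub> y) \<otimes>\<^bsub>?R\<^esub> z = x \<otimes>\<^bsub>?R\<^esub> z \<oplus>\<^bsub>?R\<^esub> y \<otimes>\<^bsub>?R\<^esub> z"
  proof (rule skew_eqI)
    fix r assume r: "r \<in> Mor G"
    interpret B: ring "A (Cod G r)" by (rule ring_cod) fact
    show "((x \<oplus>\<^bsub>?R\<^esub> y) \<otimes>\<^bsub>?R\<^esub> z) r = (x \<otimes>\<^bsub>?R\<^esub> z \<oplus>\<^bsub>?R\<^esub> y \<otimes>\<^bsub>?R\<^esub> z) r"
      unfolding add[OF r] skew_mult_eq[OF xy xyz(3) r S(1,6,2) S(1,5,2)]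
        skew_mult_eq[OF xyz(1,3) r S(1,3,2) S(1,5,2)] skew_mult_eq[OF xyz(2,3) r S(1,4,2) S(1,5,2)]
        B.finsum_addf[OF cl[OF xyz(1,3)] cl[OF xyz(2,3)], symmetric]
    proof (rule B.finsum_cong'[OF refl])
      fix p assume p: "p \<in> factorizations S S r"
      obtain s t where [simp]: "p = (s, t)" by (cases p)
      note st = factorizations_cod[OF p[simplified] S(2) S(2)]
      show "(x \<oplus>\<^bsub>?R\<^esub> y) (fst p) \<otimes>\<^bsub>A (Cod G r)\<^esub> \<sigma> (fst p) (z (snd p)) =
        x (fst p) \<otimes>\<^bsub>A (Cod G r)\<^esub> \<sigma> (fst p) (z (snd p)) \<oplus>\<^bsub>A (Cod G r)\<^esub>
        y (fst p) \<otimes>\<^bsub>A (Cod G r)\<^esub> \<sigma> (fst p) (z (snd p))"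
        using skew_carrier_closed[OF xyz(1) st(1)] skew_carrier_closed[OF xyz(2) st(1)]
          skew_term_closed(1)[OF xyz(1,3) st(1-3)] st(4)
        by (simp add: add[OF st(1)] B.l_distr)
    qed (use cl xyz in \<open>auto simp: Pi_def\<close>)
  qed (use xyz skew_mult_closed in auto)
  show "z \<otimes>\<^bsub>?R\<^esub> (x \<oplus>\<^bsub>?R\<^esub> y) = z \<otimes>\<^bsub>?R\<^esub> x \<oplus>\<^bsub>?R\<^esub> z \<otimes>\<^bsub>?R\<^esub> y"
  proof (rule skew_eqI)
    fix r assume r: "r \<in> Mor G"
    interpret B: ring "A (Cod G r)" by (rule ring_cod) fact
    show "(z \<otimes>\<^bsub>?R\<^esub> (x \<oplus>\<^bsub>?R\<^esub> y)) r = (z \<otimes>\<^bsub>?R\<^esub> x \<oplus>\<^bsub>?R\<^esub> z \<otimes>\<^bsub>?R\<^esub> y) r"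
      unfolding add[OF r] skew_mult_eq[OF xyz(3) xy r S(1,5,2) S(1,6,2)]
        skew_mult_eq[OF xyz(3,1) r S(1,5,2) S(1,3,2)] skew_mult_eq[OF xyz(3,2) r S(1,5,2) S(1,4,2)]
        B.finsum_addf[OF cl[OF xyz(3,1)] cl[OF xyz(3,2)], symmetric]
    proof (rule B.finsum_cong'[OF refl])
      fix p assume p: "p \<in> factorizations S S r"
      obtain s t where [simp]: "p = (s, t)" by (cases p)
      note st = factorizations_cod[OF p[simplified] S(2) S(2)]
      interpret h: ring_hom_ring "A (Cod G t)" "A (Cod G r)" "\<sigma> s"
        using sigma_ring_hom[OF st(1)] st(3,4) by simp
      show "z (fst p) \<otimes>\<^bsub>A (Cod G r)\<^esub> \<sigma> (fst p) ((x \<oplus>\<^bsub>?R\<^esub> y) (snd p)) =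
        z (fst p) \<otimes>\<^bsub>A (Cod G r)\<^esub> \<sigma> (fst p) (x (snd p)) \<oplus>\<^bsub>A (Cod G r)\<^esub>
        z (fst p) \<otimes>\<^bsub>A (Cod G r)\<^esub> \<sigma> (fst p) (y (snd p))"
        using skew_carrier_closed[OF xyz(1) st(2)] skew_carrier_closed[OF xyz(2) st(2)]
          skew_carrier_closed[OF xyz(3) st(1)] st(4)
        by (simp add: add[OF st(2)] B.r_distr)
    qed (use cl xyz in \<open>auto simp: Pi_def\<close>)
  qed (use xyz skew_mult_closed in auto)
qed

end

end

theory Submission
  imports Defs
begin

text \<open>
  Both directions rest on comparing \<open>a x\<close> with \<open>x a\<close> for \<open>a\<close> in the coefficient ring: at a morphism
  \<open>s\<close> the two coefficients are \<open>a\<^bsub>c(s)\<^esub> x\<^sub>s\<close> and \<open>x\<^sub>s \<sigma>\<^sub>s(a\<^bsub>d(s)\<^esub>)\<close>.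

  Suppose that \<open>A\<close> is maximal commutative, and let \<open>I\<close> be a nonzero ideal. Multiplication by some
  \<open>u\<^sub>t\<close> with \<open>t = s\<^sup>-\<^sup>1\<close> moves a nonzero coefficient from \<open>s\<close> to an identity and does not enlarge the
  support (\<open>ideal_shift_to_identity\<close>). Hence a nonzero element of \<open>I\<close> of least support size
  can be chosen with a nonzero coefficient at an identity. Its commutator with any element of \<open>A\<close>
  lies in \<open>I\<close>, is supported inside the same set and vanishes at that identity, so by
  minimality it is zero. The element therefore commutes with \<open>A\<close> and lies in \<open>A\<close>
  (\<open>ideal_meets_coefficient_ring\<close>).

  Suppose conversely that some element commuting with \<open>A\<close> has a nonzero coefficient at a morphism
  \<open>s\<close> which is not an identity. Comparing coefficients, and cancelling in a domain, shows
  that \<open>s\<close> is a loop at some object \<open>e\<close> and that \<open>\<sigma>\<^sub>s\<close> is the identity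
  (\<open>commutant_supp_same_action\<close>). Identifying two morphisms when they are parallel
  and \<open>\<sigma>\<close> takes the same value on both is a congruence of the groupoid, and it identifies \<open>s\<close>
  with \<open>e\<close>. The kernel of the passage
  to the skew ring of the quotient, i.e. the set of elements whose coefficients sum to zero over every
  class, is an ideal. It contains \<open>u\<^sub>e - u\<^sub>s\<close>, so it is nonzero; it meets \<open>A\<close> only in
  \<open>0\<close>, because different identities are never parallel and each coefficient of an element of \<open>A\<close>
  is therefore a class sum of its own (\<open>class_kernel_ideal\<close>, \<open>class_kernel_nonzero\<close>,
  \<open>class_kernel_Int_coefficient_ring\<close>).
\<close>

section \<open>Elements of the skew groupoid ring\<close>

context skew_groupoid_system
begin

abbreviation R :: "('g \<Rightarrow> 'a) ring" where
  "R \<equiv> skew_ring G A \<sigma>"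

abbreviation supp :: "('g \<Rightarrow> 'a) \<Rightarrow> 'g set" where
  "supp \<equiv> skew_support G A"

lemma supp_subset_Mor: "supp x \<subseteq> Mor G"
  by (auto simp: skew_support_def)

lemma coefficient_ring_supp:
  assumes "a \<in> coefficient_ring G A \<sigma>"
  shows "a \<in> carrier R" "finite (supp a)" "supp a \<subseteq> Ob G"
  using assms skew_support_finite by (auto simp: coefficient_ring_def)

lemma skew_add_apply: "s \<in> Mor G \<Longrightarrow> (x \<oplus>\<^bsub>R\<^esub> y) s = x s \<oplus>\<^bsub>A (Cod G s)\<^esub> y s"
  by (simp add: skew_ring_def)

lemma skew_zero_apply: "s \<in> Mor G \<Longrightarrow> \<zero>\<^bsub>R\<^esub> s = \<zero>\<^bsub>A (Cod G s)\<^esub>"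
  by (simp add: skew_ring_def)

lemma skew_minus_apply:
  assumes "x \<in> carrier R" "y \<in> carrier R" "s \<in> Mor G"
  shows "(x \<ominus>\<^bsub>R\<^esub> y) s = x s \<ominus>\<^bsub>A (Cod G s)\<^esub> y s"
proof -
  interpret R: abelian_group R by (rule skew_abelian_group)
  interpret B: ring "A (Cod G s)" by (rule ring_cod) fact
  have c: "(\<ominus>\<^bsub>R\<^esub> y) s \<in> carrier (A (Cod G s))" "y s \<in> carrier (A (Cod G s))"
    using assms skew_carrier_closed by auto
  have "(\<ominus>\<^bsub>R\<^esub> y) s \<oplus>\<^bsub>A (Cod G s)\<^esub> y s = \<zero>\<^bsub>A (Cod G s)\<^esub>"
    using assms R.l_neg[of y] skew_add_apply[of s "\<ominus>\<^bsub>R\<^esub> y" y] by (simp add: skew_zero_apply)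
  then have "(\<ominus>\<^bsub>R\<^esub> y) s = \<ominus>\<^bsub>A (Cod G s)\<^esub> y s"
    using c B.minus_equality by simp
  then show ?thesis using assms by (simp add: a_minus_def skew_add_apply)
qed

lemma supp_empty_imp_zero:
  assumes "x \<in> carrier R" "supp x = {}"
  shows "x = \<zero>\<^bsub>R\<^esub>"
proof -
  interpret R: abelian_group R by (rule skew_abelian_group)
  show ?thesis
    using assms by (intro skew_eqI) (auto simp: skew_zero_apply skew_support_def)
qed

section \<open>Multiplication by coefficients\<close>

lemma coefficient_mult_left:
  assumes a: "a \<in> coefficient_ring G A \<sigma>" and x: "x \<in> carrier R" and r: "r \<in> Mor G"
  shows "(a \<otimes>\<^bsub>R\<^esub> x) r = a (Cod G r) \<otimes>\<^bsub>A (Cod G r)\<^esub> x r"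
proof -
  interpret B: ring "A (Cod G r)" by (rule ring_cod) fact
  let ?S = "insert (Cod G r) (supp a)" and ?T = "insert r (supp x)"
  have cr: "Cod G r \<in> Mor G" "Cod G (Cod G r) = Cod G r" "Dom G (Cod G r) = Cod G r"
    using cod_ob[OF r] ob_mor ob_cod ob_dom by auto
  have ac: "a (Cod G r) \<in> carrier (A (Cod G r))"
    using skew_carrier_closed[OF coefficient_ring_supp(1)[OF a] cr(1)] cr by simp
  have xc: "x r \<in> carrier (A (Cod G r))" using x r by (rule skew_carrier_closed)
  have ob: "?S \<subseteq> Ob G" using coefficient_ring_supp(3)[OF a] cod_ob[OF r] by auto
  have fac: "factorizations ?S ?T r = {(Cod G r, r)}"
  proof (intro equalityI subsetI)
    fix p assume p: "p \<in> factorizations ?S ?T r"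
    obtain s t where st: "p = (s, t)" by (cases p)
    have "s \<in> Ob G" "t \<in> Mor G" "Dom G s = Cod G t" "Comp G s t = r"
      using p ob r supp_subset_Mor[of x] by (auto simp: factorizations_def st)
    then show "p \<in> {(Cod G r, r)}" using comp_cod ob_dom st by auto
  qed (use cr r in \<open>auto simp: factorizations_def comp_cod\<close>)
  have "(a \<otimes>\<^bsub>R\<^esub> x) r = (\<Oplus>\<^bsub>A (Cod G r)\<^esub> p \<in> factorizations ?S ?T r.
      a (fst p) \<otimes>\<^bsub>A (Cod G r)\<^esub> \<sigma> (fst p) (x (snd p)))"
    using a x r ob ob_mor skew_support_finite[OF x] supp_subset_Mor[of x] coefficient_ring_supp[OF a]
    by (intro skew_mult_eq) auto
  also have "\<dots> = a (Cod G r) \<otimes>\<^bsub>A (Cod G r)\<^esub> x r"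
    unfolding fac using ac xc cod_ob[OF r] by (simp add: sigma_id)
  finally show ?thesis .
qed

lemma coefficient_mult_right:
  assumes a: "a \<in> coefficient_ring G A \<sigma>" and x: "x \<in> carrier R" and r: "r \<in> Mor G"
  shows "(x \<otimes>\<^bsub>R\<^esub> a) r = x r \<otimes>\<^bsub>A (Cod G r)\<^esub> \<sigma> r (a (Dom G r))"
proof -
  interpret B: ring "A (Cod G r)" by (rule ring_cod) fact
  interpret h: ring_hom_ring "A (Dom G r)" "A (Cod G r)" "\<sigma> r"
    by (rule sigma_ring_hom) fact
  let ?S = "insert r (supp x)" and ?T = "insert (Dom G r) (supp a)"
  have dr: "Dom G r \<in> Mor G" "Cod G (Dom G r) = Dom G r" "Dom G (Dom G r) = Dom G r"
    using dom_ob[OF r] ob_mor ob_cod ob_dom by auto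
  have ac: "a (Dom G r) \<in> carrier (A (Dom G r))"
    using skew_carrier_closed[OF coefficient_ring_supp(1)[OF a] dr(1)] dr by simp
  have xc: "x r \<in> carrier (A (Cod G r))" using x r by (rule skew_carrier_closed)
  have ob: "?T \<subseteq> Ob G" using coefficient_ring_supp(3)[OF a] dom_ob[OF r] by auto
  have fac: "factorizations ?S ?T r = {(r, Dom G r)}"
  proof (intro equalityI subsetI)
    fix p assume p: "p \<in> factorizations ?S ?T r"
    obtain s t where st: "p = (s, t)" by (cases p)
    have "s \<in> Mor G" "t \<in> Ob G" "Dom G s = Cod G t" "Comp G s t = r"
      using p ob r supp_subset_Mor[of x] by (auto simp: factorizations_def st)
    then show "p \<in> {(r, Dom G r)}" using comp_dom[of s] ob_cod st by auto
  qed (use dr r in \<open>auto simp: factorizations_def comp_dom\<close>)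
  have "(x \<otimes>\<^bsub>R\<^esub> a) r = (\<Oplus>\<^bsub>A (Cod G r)\<^esub> p \<in> factorizations ?S ?T r.
      x (fst p) \<otimes>\<^bsub>A (Cod G r)\<^esub> \<sigma> (fst p) (a (snd p)))"
    using a x r ob ob_mor skew_support_finite[OF x] supp_subset_Mor[of x] coefficient_ring_supp[OF a]
    by (intro skew_mult_eq) auto
  also have "\<dots> = x r \<otimes>\<^bsub>A (Cod G r)\<^esub> \<sigma> r (a (Dom G r))"
    unfolding fac using ac xc by simp
  finally show ?thesis .
qed

lemma coefficient_commutes:
  assumes comm: "\<And>e. e \<in> Ob G \<Longrightarrow> cring (A e)"
    and x: "x \<in> coefficient_ring G A \<sigma>" and y: "y \<in> coefficient_ring G A \<sigma>"
  shows "x \<otimes>\<^bsub>R\<^esub> y = y \<otimes>\<^bsub>R\<^esub> x"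
proof (rule skew_eqI)
  fix r assume r: "r \<in> Mor G"
  note c = coefficient_ring_supp(1)[OF x] coefficient_ring_supp(1)[OF y]
  interpret B: cring "A (Cod G r)" using comm cod_ob[OF r] .
  interpret h: ring_hom_ring "A (Dom G r)" "A (Cod G r)" "\<sigma> r"
    by (rule sigma_ring_hom) fact
  have cl: "x (Cod G r) \<in> carrier (A (Cod G r))" "y (Cod G r) \<in> carrier (A (Cod G r))"
      "x (Dom G r) \<in> carrier (A (Dom G r))" "y (Dom G r) \<in> carrier (A (Dom G r))"
    using skew_carrier_closed c cod_ob[OF r] dom_ob[OF r] ob_mor ob_cod by metis+
  show "(x \<otimes>\<^bsub>R\<^esub> y) r = (y \<otimes>\<^bsub>R\<^esub> x) r"
  proof (cases "r \<in> Ob G")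
    case True
    then show ?thesis
      using cl r c x y
      by (simp add: coefficient_mult_left ob_cod ob_dom) (metis B.m_comm ob_cod)
  next
    case False
    then have "x r = \<zero>\<^bsub>A (Cod G r)\<^esub>" "y r = \<zero>\<^bsub>A (Cod G r)\<^esub>"
      using r coefficient_ring_supp(3)[OF x] coefficient_ring_supp(3)[OF y]
      by (auto simp: skew_support_def)
    then show ?thesis using cl r c x y by (simp add: coefficient_mult_left)
  qed
qed (use coefficient_ring_supp(1)[OF x] coefficient_ring_supp(1)[OF y] skew_mult_closed in auto)

definition monomial :: "'a \<Rightarrow> 'g \<Rightarrow> 'g \<Rightarrow> 'a" where
  "monomial b t = (\<lambda>r\<in>Mor G. if r = t then b else \<zero>\<^bsub>A (Cod G r)\<^esub>)"

lemma monomial_closed: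
  assumes "t \<in> Mor G" "b \<in> carrier (A (Cod G t))"
  shows "monomial b t \<in> carrier R"
proof (rule skew_carrierI[where S = "{t}"])
  fix s assume s: "s \<in> Mor G"
  interpret B: ring "A (Cod G s)" by (rule ring_cod) fact
  show "monomial b t s \<in> carrier (A (Cod G s))"
    using s assms(2) B.zero_closed by (cases "s = t") (simp_all add: monomial_def)
qed (auto simp: monomial_def)

lemma supp_monomial: "supp (monomial b t) \<subseteq> {t}"
  by (auto simp: monomial_def skew_support_def)

lemma monomial_in_coefficient_ring:
  assumes "e \<in> Ob G" "b \<in> carrier (A e)"
  shows "monomial b e \<in> coefficient_ring G A \<sigma>"
  using assms monomial_closed[of e b] supp_monomial[of b e] ob_mor ob_cod
  by (auto simp: coefficient_ring_def)

section \<open>Maximal commutativity forces ideals to meet the coefficients\<close>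

text \<open>
  Right multiplication by \<open>u\<^sub>t\<close>, where \<open>t\<close> is inverse to \<open>s\<close>, carries the coefficient at \<open>s\<close> to the
  identity of \<open>c(s)\<close>. Each morphism in the support is translated to at most one morphism, so the support
  cannot grow.
\<close>

lemma ideal_shift_to_identity:
  assumes I: "ideal I R" and x: "x \<in> I" and s: "s \<in> supp x"
  obtains y e where "y \<in> I" "e \<in> Ob G" "e \<in> supp y" "card (supp y) \<le> card (supp x)"
proof -
  interpret I: ideal I R by fact
  have sM: "s \<in> Mor G" using s supp_subset_Mor by auto
  obtain t where t: "t \<in> Mor G" "Dom G t = Cod G s" "Cod G t = Dom G s"
      "Comp G t s = Dom G s" "Comp G s t = Cod G s"
    using invertible[OF sM] by blast
  have xR: "x \<in> carrier R" using x I.a_subset by auto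
  interpret T: ring "A (Cod G t)" by (rule ring_cod) fact
  let ?u = "monomial \<one>\<^bsub>A (Cod G t)\<^esub> t"
  let ?y = "x \<otimes>\<^bsub>R\<^esub> ?u"
  have ut: "?u \<in> carrier R" "supp ?u \<subseteq> {t}"
    using monomial_closed[OF t(1) T.one_closed] supp_monomial by auto
  have yI: "?y \<in> I" using x ut I.I_r_closed by simp
  have eq: "?y r = (\<Oplus>\<^bsub>A (Cod G r)\<^esub> p \<in> factorizations (supp x) {t} r.
      x (fst p) \<otimes>\<^bsub>A (Cod G r)\<^esub> \<sigma> (fst p) (?u (snd p)))" if "r \<in> Mor G" for r
    using xR ut t that skew_support_finite[OF xR] supp_subset_Mor[of x]
    by (intro skew_mult_eq) auto
  have sub: "supp ?y \<subseteq> (\<lambda>q. Comp G q t) ` supp x"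
  proof
    fix r assume r: "r \<in> supp ?y"
    then have rM: "r \<in> Mor G" using supp_subset_Mor by auto
    interpret B: ring "A (Cod G r)" by (rule ring_cod) fact
    have "factorizations (supp x) {t} r \<noteq> {}"
      using r eq[OF rM] by (auto simp: skew_support_def)
    then show "r \<in> (\<lambda>q. Comp G q t) ` supp x" by (auto simp: factorizations_def)
  qed
  then have card: "card (supp ?y) \<le> card (supp x)"
    using skew_support_finite[OF xR] surj_card_le by blast
  have e: "Cod G s \<in> Ob G" "Cod G s \<in> Mor G" "Cod G (Cod G s) = Cod G s"
    using cod_ob[OF sM] ob_mor ob_cod by auto
  \<comment> \<open>Right cancellation of the invertible morphism: only \<open>s\<close> itself is carried to the identity.\<close>
  have fac: "factorizations (supp x) {t} (Cod G s) = {(s, t)}"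
  proof (intro equalityI subsetI)
    fix p assume p: "p \<in> factorizations (supp x) {t} (Cod G s)"
    then obtain q where q: "p = (q, t)" "q \<in> supp x" "Dom G q = Cod G t" "Comp G q t = Cod G s"
      by (auto simp: factorizations_def)
    have qM: "q \<in> Mor G" using q supp_subset_Mor by auto
    have "q = Comp G q (Comp G t s)" using q t comp_dom[OF qM] by simp
    also have "\<dots> = Comp G (Comp G q t) s" using comp_assoc[OF qM t(1) sM] q t by simp
    also have "\<dots> = s" using q comp_cod[OF sM] by simp
    finally show "p \<in> {(s, t)}" using q by simp
  qed (use s t in \<open>auto simp: factorizations_def\<close>)
  interpret B: ring "A (Cod G s)" by (rule ring_cod) fact
  interpret h: ring_hom_ring "A (Dom G s)" "A (Cod G s)" "\<sigma> s"
    by (rule sigma_ring_hom) fact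
  have "?y (Cod G s) = x s"
    using eq[OF e(2)] skew_carrier_closed[OF xR sM] t
    unfolding e(3) fac by (simp add: monomial_def)
  then have "Cod G s \<in> supp ?y" using e s by (simp add: skew_support_def)
  with yI e(1) card that show thesis by blast
qed

text \<open>
  An element of \<open>I\<close> of least support size, among those with a nonzero coefficient at an identity, commutes
  with all coefficients: the commutator is again in \<open>I\<close> but has lost that identity from its support.
\<close>

lemma ideal_meets_coefficient_ring:
  assumes comm: "\<And>e. e \<in> Ob G \<Longrightarrow> cring (A e)"
    and max: "commutant R (coefficient_ring G A \<sigma>) \<subseteq> coefficient_ring G A \<sigma>"
    and I: "ideal I R" and ne: "I \<noteq> {\<zero>\<^bsub>R\<^esub>}"
  shows "I \<inter> coefficient_ring G A \<sigma> \<noteq> {\<zero>\<^bsub>R\<^esub>}"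
proof -
  interpret I: ideal I R by fact
  have IR: "z \<in> carrier R" if "z \<in> I" for z using that I.a_subset by auto
  \<comment> \<open>The minimum of the support size is the same over all nonzero elements of \<open>I\<close>, by the shift; restricting to
    \<open>P\<close> lets the minimal element have its identity at hand.\<close>
  define P where "P y \<longleftrightarrow> y \<in> I \<and> (\<exists>e\<in>Ob G. e \<in> supp y)" for y
  have "\<zero>\<^bsub>R\<^esub> \<in> I" by simp
  then obtain x where x: "x \<in> I" "x \<noteq> \<zero>\<^bsub>R\<^esub>" using ne by blast
  then obtain s where "s \<in> supp x" using supp_empty_imp_zero IR by blast
  then have "\<exists>y. P y" using ideal_shift_to_identity[OF I x(1)] unfolding P_def by metis
  define y where "y = arg_min (\<lambda>z. card (supp z)) P"
  have Py: "P y" and least: "\<And>z. P z \<Longrightarrow> card (supp y) \<le> card (supp z)"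
    unfolding y_def using \<open>\<exists>y. P y\<close> arg_min_nat_lemma[of P _ "\<lambda>z. card (supp z)"] by blast+
  obtain e where y: "y \<in> I" "e \<in> Ob G" "e \<in> supp y" using Py by (auto simp: P_def)
  have yR: "y \<in> carrier R" using y IR by simp
  have "a \<otimes>\<^bsub>R\<^esub> y = y \<otimes>\<^bsub>R\<^esub> a" if a: "a \<in> coefficient_ring G A \<sigma>" for a
  proof (rule ccontr)
    assume neq: "a \<otimes>\<^bsub>R\<^esub> y \<noteq> y \<otimes>\<^bsub>R\<^esub> a"
    have aR: "a \<in> carrier R" using a coefficient_ring_supp by auto
    have pR: "a \<otimes>\<^bsub>R\<^esub> y \<in> carrier R" "y \<otimes>\<^bsub>R\<^esub> a \<in> carrier R" using aR yR by auto
    let ?z = "a \<otimes>\<^bsub>R\<^esub> y \<ominus>\<^bsub>R\<^esub> y \<otimes>\<^bsub>R\<^esub> a"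
    have zI: "?z \<in> I" using y aR I.I_l_closed I.I_r_closed by (simp add: a_minus_def)
    have zapp: "?z r = a (Cod G r) \<otimes>\<^bsub>A (Cod G r)\<^esub> y r \<ominus>\<^bsub>A (Cod G r)\<^esub>
        y r \<otimes>\<^bsub>A (Cod G r)\<^esub> \<sigma> r (a (Dom G r))" if "r \<in> Mor G" for r
      using that pR a yR
      by (simp add: skew_minus_apply coefficient_mult_left coefficient_mult_right)
    have cl: "a (Cod G r) \<in> carrier (A (Cod G r))" "\<sigma> r (a (Dom G r)) \<in> carrier (A (Cod G r))"
      if r: "r \<in> Mor G" for r
    proof -
      interpret h: ring_hom_ring "A (Dom G r)" "A (Cod G r)" "\<sigma> r"
        by (rule sigma_ring_hom) fact
      have "a (Cod G r) \<in> carrier (A (Cod G r))" "a (Dom G r) \<in> carrier (A (Dom G r))"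
        using skew_carrier_closed aR cod_ob[OF r] dom_ob[OF r] ob_mor ob_cod by metis+
      then show "a (Cod G r) \<in> carrier (A (Cod G r))" "\<sigma> r (a (Dom G r)) \<in> carrier (A (Cod G r))"
        by auto
    qed
    have sub: "supp ?z \<subseteq> supp y"
    proof
      fix r assume r: "r \<in> supp ?z"
      then have rM: "r \<in> Mor G" using supp_subset_Mor by auto
      interpret B: ring "A (Cod G r)" by (rule ring_cod) fact
      show "r \<in> supp y"
      proof (rule ccontr)
        assume "r \<notin> supp y"
        then have "y r = \<zero>\<^bsub>A (Cod G r)\<^esub>" using rM by (simp add: skew_support_def)
        then have "?z r = \<zero>\<^bsub>A (Cod G r)\<^esub>"
          using zapp[OF rM] cl[OF rM] by (simp add: B.minus_eq)
        then show False using r by (simp add: skew_support_def)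
      qed
    qed
    have eM: "e \<in> Mor G" "Cod G e = e" "Dom G e = e" using y ob_mor ob_cod ob_dom by auto
    interpret E: cring "A e" using comm y(2) .
    have "?z e = \<zero>\<^bsub>A e\<^esub>"
      using zapp[OF eM(1)] cl[OF eM(1)] skew_carrier_closed[OF yR eM(1)] y(2)
      by (simp add: eM sigma_id E.m_comm E.r_neg E.minus_eq)
    then have "e \<notin> supp ?z" using eM by (simp add: skew_support_def)
    then have "supp ?z \<subset> supp y" using sub y(3) by blast
    then have less: "card (supp ?z) < card (supp y)"
      using skew_support_finite[OF yR] psubset_card_mono by blast
    have "a \<otimes>\<^bsub>R\<^esub> y = ?z \<oplus>\<^bsub>R\<^esub> y \<otimes>\<^bsub>R\<^esub> a"
      using pR by (simp add: a_minus_def I.a_assoc I.l_neg)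
    then have "?z \<noteq> \<zero>\<^bsub>R\<^esub>" using neq pR I.l_zero by metis
    then obtain r where "r \<in> supp ?z" using supp_empty_imp_zero IR zI by blast
    \<comment> \<open>The commutator has lost \<open>e\<close> and may have no identity left in its support, hence the second shift.\<close>
    then obtain w f where w: "w \<in> I" "f \<in> Ob G" "f \<in> supp w" "card (supp w) \<le> card (supp ?z)"
      using ideal_shift_to_identity[OF I zI] by blast
    then have "P w" by (auto simp: P_def)
    then show False using least[of w] w(4) less by simp
  qed
  then have "y \<in> commutant R (coefficient_ring G A \<sigma>)" using yR by (auto simp: commutant_def)
  then have "y \<in> I \<inter> coefficient_ring G A \<sigma>" using max y by auto
  moreover have "y \<noteq> \<zero>\<^bsub>R\<^esub>" using y ob_mor by (auto simp: skew_support_def skew_zero_apply)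
  ultimately show ?thesis by blast
qed

section \<open>The congruence of morphisms acting alike\<close>

definition same_action :: "'g \<Rightarrow> 'g \<Rightarrow> bool" where
  "same_action s t \<longleftrightarrow> Dom G s = Dom G t \<and> Cod G s = Cod G t \<and>
    (\<forall>a\<in>carrier (A (Dom G s)). \<sigma> s a = \<sigma> t a)"

lemma same_action_refl: "same_action s s"
  and same_action_sym: "same_action s t \<Longrightarrow> same_action t s"
  and same_action_trans: "same_action s t \<Longrightarrow> same_action t r \<Longrightarrow> same_action s r"
  by (auto simp: same_action_def)

lemma sigma_closed:
  assumes "s \<in> Mor G" "a \<in> carrier (A (Dom G s))"
  shows "\<sigma> s a \<in> carrier (A (Cod G s))"
  using sigma_hom[OF assms(1)] assms(2) by (auto simp: ring_hom_def)

lemma sigma_inverse: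
  assumes s: "s \<in> Mor G"
  obtains t where "t \<in> Mor G" "Dom G t = Cod G s" "Cod G t = Dom G s"
    "\<And>a. a \<in> carrier (A (Dom G s)) \<Longrightarrow> \<sigma> t (\<sigma> s a) = a"
    "\<And>a. a \<in> carrier (A (Cod G s)) \<Longrightarrow> \<sigma> s (\<sigma> t a) = a"
proof -
  obtain t where t: "t \<in> Mor G" "Dom G t = Cod G s" "Cod G t = Dom G s"
      "Comp G t s = Dom G s" "Comp G s t = Cod G s"
    using invertible[OF s] by blast
  show thesis
    by (rule that[OF t(1-3)]) (use s t in \<open>auto simp: sigma_comp sigma_id dom_ob cod_ob\<close>)
qed

text \<open>
  Since \<open>\<sigma>\<^sub>s\<close> is bijective, composition with a fixed morphism both preserves and reflects the relation.
  Reflection makes the factors \<open>t\<close> with \<open>st\<close> in a given class fill out a single class, which is what lets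
  the class sums of a product factor through class sums of one of its factors.
\<close>

lemma same_action_left_iff:
  assumes "s \<in> Mor G" "t \<in> Mor G" "t' \<in> Mor G" "Dom G s = Cod G t" "Dom G s = Cod G t'"
  shows "same_action (Comp G s t) (Comp G s t') \<longleftrightarrow> same_action t t'"
proof
  assume L: "same_action (Comp G s t) (Comp G s t')"
  obtain q where q: "q \<in> Mor G"
      "\<And>a. a \<in> carrier (A (Dom G s)) \<Longrightarrow> \<sigma> q (\<sigma> s a) = a"
    using sigma_inverse[OF assms(1)] by metis
  have d: "Dom G t = Dom G t'" using L assms by (simp add: same_action_def dom_comp)
  have "\<sigma> t a = \<sigma> t' a" if a: "a \<in> carrier (A (Dom G t))" for a
  proof -
    have a': "a \<in> carrier (A (Dom G t'))" "a \<in> carrier (A (Dom G (Comp G s t)))"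
      using a d dom_comp[OF assms(1,2,4)] by simp_all
    have "\<sigma> s (\<sigma> t a) = \<sigma> (Comp G s t) a"
      using sigma_comp[OF assms(1,2,4) a] .
    also have "\<dots> = \<sigma> (Comp G s t') a" using L a'(2) by (simp only: same_action_def)
    also have "\<dots> = \<sigma> s (\<sigma> t' a)" using sigma_comp[OF assms(1,3,5) a'(1)] by (rule sym)
    finally have "\<sigma> q (\<sigma> s (\<sigma> t a)) = \<sigma> q (\<sigma> s (\<sigma> t' a))" by (rule arg_cong)
    moreover have "\<sigma> t a \<in> carrier (A (Dom G s))" "\<sigma> t' a \<in> carrier (A (Dom G s))"
      using sigma_closed[OF assms(2) a] sigma_closed[OF assms(3) a'(1)] assms(4,5) by simp_all
    ultimately show ?thesis by (simp only: q(2))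
  qed
  then show "same_action t t'" using d assms by (simp add: same_action_def)
next
  assume R: "same_action t t'"
  then show "same_action (Comp G s t) (Comp G s t')"
    using assms by (auto simp: same_action_def dom_comp cod_comp sigma_comp[symmetric])
qed

lemma same_action_right_iff:
  assumes "s \<in> Mor G" "s' \<in> Mor G" "t \<in> Mor G" "Dom G s = Cod G t" "Dom G s' = Cod G t"
  shows "same_action (Comp G s t) (Comp G s' t) \<longleftrightarrow> same_action s s'"
proof
  assume L: "same_action (Comp G s t) (Comp G s' t)"
  obtain q where q: "q \<in> Mor G" "Dom G q = Cod G t" "Cod G q = Dom G t"
      "\<And>a. a \<in> carrier (A (Cod G t)) \<Longrightarrow> \<sigma> t (\<sigma> q a) = a"
    using sigma_inverse[OF assms(3)] by metis
  have "\<sigma> s a = \<sigma> s' a" if a: "a \<in> carrier (A (Dom G s))" for a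
  proof -
    have qa: "\<sigma> q a \<in> carrier (A (Dom G t))" using sigma_closed[OF q(1)] a assms q by simp
    then have "\<sigma> s (\<sigma> t (\<sigma> q a)) = \<sigma> s' (\<sigma> t (\<sigma> q a))"
      using L assms by (simp add: same_action_def dom_comp sigma_comp[symmetric])
    then show ?thesis using q(4) a assms by simp
  qed
  then show "same_action s s'" using L assms by (simp add: same_action_def cod_comp)
next
  assume R: "same_action s s'"
  then show "same_action (Comp G s t) (Comp G s' t)"
    using assms sigma_closed[OF assms(3)]
    by (auto simp: same_action_def dom_comp cod_comp sigma_comp[symmetric])
qed

section \<open>Sums of coefficients over congruence classes\<close>

text \<open>
  The coefficient at the class of \<open>r\<close> of the image of \<open>x\<close> in the skew groupoid ring of the quotient by the
  congruence.
\<close>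

definition class_sum :: "('g \<Rightarrow> 'a) \<Rightarrow> 'g \<Rightarrow> 'a" where
  "class_sum x r = (\<Oplus>\<^bsub>A (Cod G r)\<^esub> t \<in> {t \<in> supp x. same_action t r}. x t)"

lemma class_term_closed:
  assumes "x \<in> carrier R" "t \<in> Mor G" "same_action t r"
  shows "x t \<in> carrier (A (Cod G r))"
  using skew_carrier_closed[OF assms(1,2)] assms(3) by (simp add: same_action_def)

text \<open>Allows sums over the supports of several elements to be taken over a common finite set.\<close>

lemma class_sum_eq:
  assumes x: "x \<in> carrier R" and r: "r \<in> Mor G"
    and S: "finite S" "supp x \<subseteq> S" "S \<subseteq> Mor G"
  shows "class_sum x r = (\<Oplus>\<^bsub>A (Cod G r)\<^esub> t \<in> {t \<in> S. same_action t r}. x t)"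
proof -
  interpret B: ring "A (Cod G r)" by (rule ring_cod) fact
  show ?thesis
    unfolding class_sum_def
  proof (rule B.add.finprod_mono_neutral_cong_left)
    fix t assume "t \<in> {t \<in> S. same_action t r} - {t \<in> supp x. same_action t r}"
    then show "x t = \<zero>\<^bsub>A (Cod G r)\<^esub>"
      using S by (auto simp: skew_support_def same_action_def)
  qed (use S x class_term_closed in auto)
qed

lemma class_sum_add:
  assumes x: "x \<in> carrier R" and y: "y \<in> carrier R" and r: "r \<in> Mor G"
  shows "class_sum (x \<oplus>\<^bsub>R\<^esub> y) r = class_sum x r \<oplus>\<^bsub>A (Cod G r)\<^esub> class_sum y r"
proof -
  interpret R: abelian_group R by (rule skew_abelian_group)
  interpret B: ring "A (Cod G r)" by (rule ring_cod) fact
  define S where "S = supp x \<union> supp y \<union> supp (x \<oplus>\<^bsub>R\<^esub> y)"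
  have S: "finite S" "S \<subseteq> Mor G" "supp x \<subseteq> S" "supp y \<subseteq> S" "supp (x \<oplus>\<^bsub>R\<^esub> y) \<subseteq> S"
    using x y skew_support_finite supp_subset_Mor by (auto simp: S_def)
  let ?C = "{t \<in> S. same_action t r}"
  have "class_sum (x \<oplus>\<^bsub>R\<^esub> y) r = (\<Oplus>\<^bsub>A (Cod G r)\<^esub> t \<in> ?C. (x \<oplus>\<^bsub>R\<^esub> y) t)"
    using x y r S by (intro class_sum_eq) auto
  also have "\<dots> = (\<Oplus>\<^bsub>A (Cod G r)\<^esub> t \<in> ?C. x t \<oplus>\<^bsub>A (Cod G r)\<^esub> y t)"
    using S(2) x y by (intro B.finsum_cong' refl)
      (auto simp: skew_add_apply class_term_closed same_action_def subset_iff
        intro!: B.a_closed class_term_closed)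
  also have "\<dots> = (\<Oplus>\<^bsub>A (Cod G r)\<^esub> t \<in> ?C. x t) \<oplus>\<^bsub>A (Cod G r)\<^esub> (\<Oplus>\<^bsub>A (Cod G r)\<^esub> t \<in> ?C. y t)"
    using S(2) x y by (intro B.finsum_addf) (auto intro!: class_term_closed)
  also have "\<dots> = class_sum x r \<oplus>\<^bsub>A (Cod G r)\<^esub> class_sum y r"
    using x y r S class_sum_eq[OF x r S(1,3,2)] class_sum_eq[OF y r S(1,4,2)] by simp
  finally show ?thesis .
qed

definition class_factorizations :: "'g set \<Rightarrow> 'g set \<Rightarrow> 'g \<Rightarrow> ('g \<times> 'g) set" where
  "class_factorizations S T r =
    {(s, t). s \<in> S \<and> t \<in> T \<and> Dom G s = Cod G t \<and> same_action (Comp G s t) r}"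

lemma finite_class_factorizations:
  "finite S \<Longrightarrow> finite T \<Longrightarrow> finite (class_factorizations S T r)"
  by (rule finite_subset[of _ "S \<times> T"]) (auto simp: class_factorizations_def)

lemma class_factorizations_closed:
  assumes x: "x \<in> carrier R" and y: "y \<in> carrier R"
    and p: "(s, t) \<in> class_factorizations (supp x) (supp y) r"
  shows "x s \<otimes>\<^bsub>A (Cod G r)\<^esub> \<sigma> s (y t) \<in> carrier (A (Cod G r))"
proof -
  have st: "s \<in> Mor G" "t \<in> Mor G" "Dom G s = Cod G t" "same_action (Comp G s t) r"
    using p supp_subset_Mor by (auto simp: class_factorizations_def)
  then have "Cod G s = Cod G r" by (simp add: same_action_def cod_comp)
  then show ?thesis using skew_term_closed(2)[OF x y st(1-3)] by simp
qed

text \<open>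
  Grouping the pairs \<open>(s, t)\<close> by their composite \<open>st\<close> turns the class sum of a product into one sum over
  all pairs with composite in the class; the later lemmas regroup this sum by \<open>s\<close> or by \<open>t\<close>.
\<close>

lemma class_sum_mult:
  assumes x: "x \<in> carrier R" and y: "y \<in> carrier R" and r: "r \<in> Mor G"
  shows "class_sum (x \<otimes>\<^bsub>R\<^esub> y) r =
    (\<Oplus>\<^bsub>A (Cod G r)\<^esub> p \<in> class_factorizations (supp x) (supp y) r.
      x (fst p) \<otimes>\<^bsub>A (Cod G r)\<^esub> \<sigma> (fst p) (y (snd p)))"
proof -
  interpret B: ring "A (Cod G r)" by (rule ring_cod) fact
  let ?F = "\<lambda>p. x (fst p) \<otimes>\<^bsub>A (Cod G r)\<^esub> \<sigma> (fst p) (y (snd p))"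
  have xy: "x \<otimes>\<^bsub>R\<^esub> y \<in> carrier R" using x y by (rule skew_mult_closed)
  have fin: "finite (supp x)" "finite (supp y)" using x y skew_support_finite by auto
  \<comment> \<open>A finite set that contains the support of the product and all composites, so that every pair is counted
    even if the coefficient at its composite cancels.\<close>
  define P where "P = supp (x \<otimes>\<^bsub>R\<^esub> y) \<union>
    (\<lambda>(s, t). Comp G s t) ` {(s, t) \<in> supp x \<times> supp y. Dom G s = Cod G t}"
  have P: "finite P" "supp (x \<otimes>\<^bsub>R\<^esub> y) \<subseteq> P" "P \<subseteq> Mor G"
  proof -
    have "finite {(s, t) \<in> supp x \<times> supp y. Dom G s = Cod G t}"
      by (rule finite_subset[of _ "supp x \<times> supp y"]) (use fin in auto)
    then show "finite P" using skew_support_finite[OF xy] by (simp add: P_def)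
    show "supp (x \<otimes>\<^bsub>R\<^esub> y) \<subseteq> P" by (simp add: P_def)
    show "P \<subseteq> Mor G" unfolding P_def
      using supp_subset_Mor[of x] supp_subset_Mor[of y] supp_subset_Mor[of "x \<otimes>\<^bsub>R\<^esub> y"]
      by (auto intro!: comp_mor)
  qed
  let ?C = "{u \<in> P. same_action u r}"
  have sub: "factorizations (supp x) (supp y) u \<subseteq> class_factorizations (supp x) (supp y) r"
    if "u \<in> ?C" for u
    using that by (auto simp: factorizations_def class_factorizations_def)
  have cl: "?F p \<in> carrier (A (Cod G r))" if "p \<in> class_factorizations (supp x) (supp y) r" for p
    using class_factorizations_closed[OF x y] that by (cases p) auto
  have "class_sum (x \<otimes>\<^bsub>R\<^esub> y) r = (\<Oplus>\<^bsub>A (Cod G r)\<^esub> u \<in> ?C. (x \<otimes>\<^bsub>R\<^esub> y) u)"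
    using class_sum_eq[OF xy r P] .
  also have "\<dots> = (\<Oplus>\<^bsub>A (Cod G r)\<^esub> u \<in> ?C. \<Oplus>\<^bsub>A (Cod G r)\<^esub> p \<in> factorizations (supp x) (supp y) u. ?F p)"
  proof (rule B.finsum_cong'[OF refl])
    show "(\<lambda>u. \<Oplus>\<^bsub>A (Cod G r)\<^esub> p \<in> factorizations (supp x) (supp y) u. ?F p) \<in> ?C \<rightarrow> carrier (A (Cod G r))"
      using sub cl by (blast intro: B.finsum_closed)
    fix u assume u: "u \<in> ?C"
    then have uM: "u \<in> Mor G" "Cod G u = Cod G r" using P by (auto simp: same_action_def)
    show "(x \<otimes>\<^bsub>R\<^esub> y) u = (\<Oplus>\<^bsub>A (Cod G r)\<^esub> p \<in> factorizations (supp x) (supp y) u. ?F p)"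
      using skew_mult_eq[OF x y uM(1) fin(1) order.refl supp_subset_Mor fin(2) order.refl supp_subset_Mor]
      unfolding uM(2) .
  qed
  also have "\<dots> = (\<Oplus>\<^bsub>A (Cod G r)\<^esub> p \<in> (\<Union>u\<in>?C. factorizations (supp x) (supp y) u). ?F p)"
  proof (rule B.add.finprod_UN_disjoint[symmetric])
    show "pairwise (\<lambda>u v. disjnt (factorizations (supp x) (supp y) u) (factorizations (supp x) (supp y) v)) ?C"
      by (auto simp: pairwise_def disjnt_def factorizations_def)
  qed (use P fin sub cl finite_factorizations in \<open>auto simp: subset_iff\<close>)
  also have "(\<Union>u\<in>?C. factorizations (supp x) (supp y) u) = class_factorizations (supp x) (supp y) r"
    by (auto simp: P_def factorizations_def class_factorizations_def)
  finally show ?thesis .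
qed

section \<open>The ideal of elements with vanishing class sums\<close>

definition class_kernel :: "('g \<Rightarrow> 'a) set" where
  "class_kernel = {x \<in> carrier R. \<forall>r\<in>Mor G. class_sum x r = \<zero>\<^bsub>A (Cod G r)\<^esub>}"

text \<open>
  For fixed \<open>s\<close> the right factors \<open>t\<close> with \<open>st\<close> in the class of \<open>r\<close> form one class, and
  additivity of \<open>\<sigma>\<^sub>s\<close> reduces the inner sum \<open>\<Sum> y\<^sub>s \<sigma>\<^sub>s(x\<^sub>t)\<close> to \<open>y\<^sub>s \<sigma>\<^sub>s\<close> of a class sum of \<open>x\<close>.
\<close>

lemma class_kernel_mult_left:
  assumes x: "x \<in> class_kernel" and y: "y \<in> carrier R"
  shows "y \<otimes>\<^bsub>R\<^esub> x \<in> class_kernel"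
proof -
  have xR: "x \<in> carrier R" using x by (simp add: class_kernel_def)
  have fin: "finite (supp x)" "finite (supp y)" using xR y skew_support_finite by auto
  have "class_sum (y \<otimes>\<^bsub>R\<^esub> x) r = \<zero>\<^bsub>A (Cod G r)\<^esub>" if r: "r \<in> Mor G" for r
  proof -
    interpret B: ring "A (Cod G r)" by (rule ring_cod) fact
    let ?T = "\<lambda>s. {t \<in> supp x. Dom G s = Cod G t \<and> same_action (Comp G s t) r}"
    let ?F = "\<lambda>p. y (fst p) \<otimes>\<^bsub>A (Cod G r)\<^esub> \<sigma> (fst p) (x (snd p))"
    have "class_sum (y \<otimes>\<^bsub>R\<^esub> x) r =
      (\<Oplus>\<^bsub>A (Cod G r)\<^esub> p \<in> class_factorizations (supp y) (supp x) r. ?F p)"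
      by (rule class_sum_mult[OF y xR r])
    also have "class_factorizations (supp y) (supp x) r = Sigma (supp y) ?T"
      by (auto simp: class_factorizations_def)
    also have "(\<Oplus>\<^bsub>A (Cod G r)\<^esub> p \<in> Sigma (supp y) ?T. ?F p) =
        (\<Oplus>\<^bsub>A (Cod G r)\<^esub> s \<in> supp y. \<Oplus>\<^bsub>A (Cod G r)\<^esub> t \<in> ?T s. y s \<otimes>\<^bsub>A (Cod G r)\<^esub> \<sigma> s (x t))"
      by (rule B.finsum_Sigma[symmetric])
        (use fin class_factorizations_closed[OF y xR] in \<open>auto simp: class_factorizations_def\<close>)
    also have "\<dots> = (\<Oplus>\<^bsub>A (Cod G r)\<^esub> s \<in> supp y. \<zero>\<^bsub>A (Cod G r)\<^esub>)"
    proof (rule B.finsum_cong'[OF refl])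
      fix s assume s: "s \<in> supp y"
      then have sM: "s \<in> Mor G" using supp_subset_Mor by auto
      show "(\<Oplus>\<^bsub>A (Cod G r)\<^esub> t \<in> ?T s. y s \<otimes>\<^bsub>A (Cod G r)\<^esub> \<sigma> s (x t)) = \<zero>\<^bsub>A (Cod G r)\<^esub>"
      proof (cases "?T s = {}")
        case False
        then obtain t0 where t0: "t0 \<in> Mor G" "Dom G s = Cod G t0" "same_action (Comp G s t0) r"
          using supp_subset_Mor by blast
        have cod: "Cod G s = Cod G r" using t0 sM by (simp add: same_action_def cod_comp)
        interpret h: ring_hom_ring "A (Dom G s)" "A (Cod G r)" "\<sigma> s"
          using sigma_ring_hom[OF sM] cod by simp
        have T: "?T s = {t \<in> supp x. same_action t t0}"
        proof (intro Collect_cong conj_cong refl)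
          fix t assume "t \<in> supp x"
          then have tM: "t \<in> Mor G" using supp_subset_Mor by auto
          show "(Dom G s = Cod G t \<and> same_action (Comp G s t) r) = same_action t t0"
            using same_action_left_iff[OF sM tM t0(1)] t0 same_action_sym same_action_trans
            by (metis same_action_def)
        qed
        have xc: "x t \<in> carrier (A (Dom G s))" if "t \<in> ?T s" for t
          using that skew_carrier_closed[OF xR, of t] supp_subset_Mor by auto
        have yc: "y s \<in> carrier (A (Cod G r))" using skew_carrier_closed[OF y sM] cod by simp
        have finT: "finite (?T s)" using fin by simp
        have "(\<Oplus>\<^bsub>A (Cod G r)\<^esub> t \<in> ?T s. y s \<otimes>\<^bsub>A (Cod G r)\<^esub> \<sigma> s (x t)) =
            y s \<otimes>\<^bsub>A (Cod G r)\<^esub> (\<Oplus>\<^bsub>A (Cod G r)\<^esub> t \<in> ?T s. \<sigma> s (x t))"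
          by (rule B.finsum_rdistr[symmetric]) (use yc finT xc in auto)
        also have "(\<Oplus>\<^bsub>A (Cod G r)\<^esub> t \<in> ?T s. \<sigma> s (x t)) = \<sigma> s (\<Oplus>\<^bsub>A (Dom G s)\<^esub> t \<in> ?T s. x t)"
          by (rule h.R.ring_hom_finsum[OF B.ring_axioms h.homh, symmetric]) (use finT xc in auto)
        also have "(\<Oplus>\<^bsub>A (Dom G s)\<^esub> t \<in> ?T s. x t) = class_sum x t0"
          by (simp only: T class_sum_def t0(2)[symmetric])
        also have "\<dots> = \<zero>\<^bsub>A (Dom G s)\<^esub>" using x t0 by (simp add: class_kernel_def)
        finally show ?thesis using yc by simp
      qed (simp only: B.finsum_empty)
    qed auto
    finally show ?thesis by simp
  qed
  then show ?thesis using skew_mult_closed[OF y xR] by (simp add: class_kernel_def)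
qed

text \<open>
  For fixed \<open>t\<close> the left factors \<open>s\<close> form one class, on which \<open>\<sigma>\<^sub>s(y\<^sub>t)\<close> does not depend on \<open>s\<close> and
  can be taken out of the sum.
\<close>

lemma class_kernel_mult_right:
  assumes x: "x \<in> class_kernel" and y: "y \<in> carrier R"
  shows "x \<otimes>\<^bsub>R\<^esub> y \<in> class_kernel"
proof -
  have xR: "x \<in> carrier R" using x by (simp add: class_kernel_def)
  have fin: "finite (supp x)" "finite (supp y)" using xR y skew_support_finite by auto
  have "class_sum (x \<otimes>\<^bsub>R\<^esub> y) r = \<zero>\<^bsub>A (Cod G r)\<^esub>" if r: "r \<in> Mor G" for r
  proof -
    interpret B: ring "A (Cod G r)" by (rule ring_cod) fact
    let ?S = "\<lambda>t. {s \<in> supp x. Dom G s = Cod G t \<and> same_action (Comp G s t) r}"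
    let ?F = "\<lambda>p. x (fst p) \<otimes>\<^bsub>A (Cod G r)\<^esub> \<sigma> (fst p) (y (snd p))"
    have cl: "?F p \<in> carrier (A (Cod G r))" if "p \<in> class_factorizations (supp x) (supp y) r" for p
      using class_factorizations_closed[OF xR y] that by (cases p) auto
    have "class_sum (x \<otimes>\<^bsub>R\<^esub> y) r =
      (\<Oplus>\<^bsub>A (Cod G r)\<^esub> p \<in> class_factorizations (supp x) (supp y) r. ?F p)"
      by (rule class_sum_mult[OF xR y r])
    also have "class_factorizations (supp x) (supp y) r = prod.swap ` Sigma (supp y) ?S"
      by (force simp: class_factorizations_def)
    also have "(\<Oplus>\<^bsub>A (Cod G r)\<^esub> p \<in> prod.swap ` Sigma (supp y) ?S. ?F p) =
        (\<Oplus>\<^bsub>A (Cod G r)\<^esub> p \<in> Sigma (supp y) ?S. ?F (prod.swap p))"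
      by (rule B.finsum_reindex) (use cl in \<open>auto simp: class_factorizations_def\<close>)
    also have "\<dots> = (\<Oplus>\<^bsub>A (Cod G r)\<^esub> p \<in> Sigma (supp y) ?S.
        x (snd p) \<otimes>\<^bsub>A (Cod G r)\<^esub> \<sigma> (snd p) (y (fst p)))" by simp
    also have "\<dots> =
        (\<Oplus>\<^bsub>A (Cod G r)\<^esub> t \<in> supp y. \<Oplus>\<^bsub>A (Cod G r)\<^esub> s \<in> ?S t. x s \<otimes>\<^bsub>A (Cod G r)\<^esub> \<sigma> s (y t))"
      by (rule B.finsum_Sigma[symmetric])
        (use fin class_factorizations_closed[OF xR y] in \<open>auto simp: class_factorizations_def\<close>)
    also have "\<dots> = (\<Oplus>\<^bsub>A (Cod G r)\<^esub> t \<in> supp y. \<zero>\<^bsub>A (Cod G r)\<^esub>)"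
    proof (rule B.finsum_cong'[OF refl])
      fix t assume t: "t \<in> supp y"
      then have tM: "t \<in> Mor G" using supp_subset_Mor by auto
      show "(\<Oplus>\<^bsub>A (Cod G r)\<^esub> s \<in> ?S t. x s \<otimes>\<^bsub>A (Cod G r)\<^esub> \<sigma> s (y t)) = \<zero>\<^bsub>A (Cod G r)\<^esub>"
      proof (cases "?S t = {}")
        case False
        then obtain s0 where s0: "s0 \<in> Mor G" "Dom G s0 = Cod G t" "same_action (Comp G s0 t) r"
          using supp_subset_Mor by blast
        have cod: "Cod G s0 = Cod G r" using s0 tM by (simp add: same_action_def cod_comp)
        have S: "?S t = {s \<in> supp x. same_action s s0}"
        proof (intro Collect_cong conj_cong refl)
          fix s assume "s \<in> supp x"
          then have sM: "s \<in> Mor G" using supp_subset_Mor by auto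
          show "(Dom G s = Cod G t \<and> same_action (Comp G s t) r) = same_action s s0"
            using same_action_right_iff[OF sM s0(1) tM] s0 same_action_sym same_action_trans
            by (metis same_action_def)
        qed
        have yc: "y t \<in> carrier (A (Dom G s0))" using skew_carrier_closed[OF y tM] s0 by simp
        have sy: "\<sigma> s0 (y t) \<in> carrier (A (Cod G r))" using sigma_closed[OF s0(1) yc] cod by simp
        have xc: "x s \<in> carrier (A (Cod G r))" if "s \<in> supp x" "same_action s s0" for s
          using that class_term_closed[OF xR, of s s0] supp_subset_Mor cod by auto
        have sig: "\<sigma> s (y t) = \<sigma> s0 (y t)" if "same_action s s0" for s
          using that yc by (simp add: same_action_def)
        have "(\<Oplus>\<^bsub>A (Cod G r)\<^esub> s \<in> ?S t. x s \<otimes>\<^bsub>A (Cod G r)\<^esub> \<sigma> s (y t)) =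
            (\<Oplus>\<^bsub>A (Cod G r)\<^esub> s \<in> {s \<in> supp x. same_action s s0}. x s \<otimes>\<^bsub>A (Cod G r)\<^esub> \<sigma> s0 (y t))"
          unfolding S by (rule B.finsum_cong'[OF refl]) (use xc sy sig in auto)
        also have "\<dots> = (\<Oplus>\<^bsub>A (Cod G r)\<^esub> s \<in> {s \<in> supp x. same_action s s0}. x s)
            \<otimes>\<^bsub>A (Cod G r)\<^esub> \<sigma> s0 (y t)"
          by (rule B.finsum_ldistr[symmetric]) (use fin xc sy in auto)
        also have "(\<Oplus>\<^bsub>A (Cod G r)\<^esub> s \<in> {s \<in> supp x. same_action s s0}. x s) = class_sum x s0"
          unfolding class_sum_def cod ..
        also have "\<dots> = \<zero>\<^bsub>A (Cod G r)\<^esub>" using x s0 cod by (simp add: class_kernel_def)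
        finally show ?thesis using sy by simp
      qed (simp only: B.finsum_empty)
    qed auto
    finally show ?thesis by simp
  qed
  then show ?thesis using skew_mult_closed[OF xR y] by (simp add: class_kernel_def)
qed

lemma class_kernel_ideal:
  assumes "finite (Ob G)"
  shows "ideal class_kernel R"
proof -
  interpret R: ring R by (rule skew_ring_is_ring) fact
  have sub: "class_kernel \<subseteq> carrier R" by (auto simp: class_kernel_def)
  show ?thesis
  proof (rule idealI)
    show "subgroup class_kernel (add_monoid R)"
    proof (rule R.add.subgroupI)
      have "supp \<zero>\<^bsub>R\<^esub> = {}" by (auto simp: skew_support_def skew_zero_apply)
      then have "\<zero>\<^bsub>R\<^esub> \<in> class_kernel"
        using ring_cod by (auto simp: class_kernel_def class_sum_def ring.axioms
            abelian_monoid.finsum_empty abelian_group.axioms)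
      then show "class_kernel \<noteq> {}" by blast
      show "\<ominus>\<^bsub>R\<^esub> x \<in> class_kernel" if "x \<in> class_kernel" for x
        using class_kernel_mult_left[OF that, of "\<ominus>\<^bsub>R\<^esub> \<one>\<^bsub>R\<^esub>"] that sub by (auto simp: R.l_minus)
      show "x \<oplus>\<^bsub>R\<^esub> y \<in> class_kernel" if "x \<in> class_kernel" "y \<in> class_kernel" for x y
      proof -
        have "class_sum (x \<oplus>\<^bsub>R\<^esub> y) r = \<zero>\<^bsub>A (Cod G r)\<^esub>" if r: "r \<in> Mor G" for r
        proof -
          interpret B: ring "A (Cod G r)" by (rule ring_cod) fact
          show ?thesis
            using class_sum_add[of x y r] \<open>x \<in> class_kernel\<close> \<open>y \<in> class_kernel\<close> r
            by (simp add: class_kernel_def)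
        qed
        then show ?thesis using that by (simp add: class_kernel_def)
      qed
    qed (use sub in auto)
  qed (use R.ring_axioms class_kernel_mult_left class_kernel_mult_right in auto)
qed

text \<open>
  An identity is the only identity in its class, so the class sums of an element of \<open>A\<close> at
  identities are its coefficients.
\<close>

lemma class_kernel_Int_coefficient_ring:
  assumes x: "x \<in> class_kernel" "x \<in> coefficient_ring G A \<sigma>"
  shows "x = \<zero>\<^bsub>R\<^esub>"
proof (rule supp_empty_imp_zero)
  show xR: "x \<in> carrier R" using x by (simp add: class_kernel_def)
  show "supp x = {}"
  proof (rule ccontr)
    assume "supp x \<noteq> {}"
    then obtain f where f: "f \<in> supp x" by blast
    have sub: "supp x \<subseteq> Ob G" using coefficient_ring_supp x by auto
    then have fM: "f \<in> Mor G" "f \<in> Ob G" using f ob_mor by auto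
    interpret B: ring "A (Cod G f)" by (rule ring_cod) fact
    have "{t \<in> supp x. same_action t f} = {f}"
      using f sub fM by (auto simp: same_action_refl) (metis same_action_def ob_dom subsetD)
    then have "class_sum x f = x f"
      using skew_carrier_closed[OF xR fM(1)] by (simp add: class_sum_def)
    then show False using x fM f by (simp add: class_kernel_def skew_support_def)
  qed
qed

text \<open>The witness is \<open>u\<^sub>e - u\<^sub>s\<close>.\<close>

lemma class_kernel_nonzero:
  assumes s: "s \<in> Mor G" "s \<notin> Ob G" and e: "e \<in> Ob G" and se: "same_action s e"
    and nontriv: "\<one>\<^bsub>A e\<^esub> \<noteq> \<zero>\<^bsub>A e\<^esub>"
  shows "class_kernel \<noteq> {\<zero>\<^bsub>R\<^esub>}"
proof -
  have eM: "e \<in> Mor G" "Cod G e = e" using e ob_mor ob_cod by auto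
  have cs: "Cod G s = e" using se eM by (simp add: same_action_def)
  have ne: "e \<noteq> s" using s e by auto
  interpret E: ring "A e" using ring_A e .
  define z where "z = (\<lambda>r\<in>Mor G. if r = e then \<one>\<^bsub>A e\<^esub> else if r = s then \<ominus>\<^bsub>A e\<^esub> \<one>\<^bsub>A e\<^esub>
    else \<zero>\<^bsub>A (Cod G r)\<^esub>)"
  have z: "z e = \<one>\<^bsub>A e\<^esub>" "z s = \<ominus>\<^bsub>A e\<^esub> \<one>\<^bsub>A e\<^esub>" using eM s ne by (auto simp: z_def)
  have zR: "z \<in> carrier R"
  proof (rule skew_carrierI[where S = "{e, s}"])
    fix r assume r: "r \<in> Mor G"
    interpret B: ring "A (Cod G r)" by (rule ring_cod) fact
    show "z r \<in> carrier (A (Cod G r))" using r eM cs by (simp add: z_def)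
  qed (auto simp: z_def)
  have "class_sum z r = \<zero>\<^bsub>A (Cod G r)\<^esub>" if r: "r \<in> Mor G" for r
  proof -
    interpret B: ring "A (Cod G r)" by (rule ring_cod) fact
    have eq: "class_sum z r = (\<Oplus>\<^bsub>A (Cod G r)\<^esub> t \<in> {t \<in> {e, s}. same_action t r}. z t)"
      by (rule class_sum_eq[OF zR r]) (use eM s in \<open>auto simp: z_def skew_support_def\<close>)
    show ?thesis
    proof (cases "same_action e r")
      case True
      then have "{t \<in> {e, s}. same_action t r} = {e, s}" using se same_action_trans by blast
      moreover have "Cod G r = e" using True eM by (simp add: same_action_def)
      ultimately show ?thesis using eq ne z by (simp add: E.r_neg)
    next
      case False
      then have "{t \<in> {e, s}. same_action t r} = {}"
        using se same_action_sym same_action_trans by blast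
      then show ?thesis by (simp only: eq B.finsum_empty)
    qed
  qed
  then have "z \<in> class_kernel" using zR by (simp add: class_kernel_def)
  moreover have "z \<noteq> \<zero>\<^bsub>R\<^esub>" using z(1) nontriv eM by (auto simp: skew_zero_apply)
  ultimately show ?thesis by blast
qed

section \<open>Elements commuting with the coefficients\<close>

text \<open>
  Commuting with \<open>u\<^bsub>c(s)\<^esub>\<close> excludes \<open>d(s) \<noteq> c(s)\<close>, where \<open>x\<^sub>s = 0\<close> would follow. Commuting with
  \<open>b u\<^bsub>c(s)\<^esub>\<close> then gives \<open>b x\<^sub>s = x\<^sub>s \<sigma>\<^sub>s(b)\<close>, and \<open>x\<^sub>s\<close> can be cancelled.
\<close>

lemma commutant_supp_same_action:
  assumes dom: "\<And>e. e \<in> Ob G \<Longrightarrow> domain (A e)"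
    and x: "x \<in> commutant R (coefficient_ring G A \<sigma>)" and s: "s \<in> supp x"
  shows "same_action s (Cod G s)"
proof -
  let ?c = "Cod G s" and ?d = "Dom G s"
  have xR: "x \<in> carrier R" using x by (simp add: commutant_def)
  have sM: "s \<in> Mor G" using s supp_subset_Mor by auto
  have c: "?c \<in> Ob G" "?c \<in> Mor G" "Cod G ?c = ?c" "Dom G ?c = ?c"
    and d: "?d \<in> Ob G" "?d \<in> Mor G" "Cod G ?d = ?d"
    using cod_ob[OF sM] dom_ob[OF sM] ob_mor ob_cod ob_dom by auto
  interpret B: domain "A ?c" using dom c(1) .
  interpret h: ring_hom_ring "A ?d" "A ?c" "\<sigma> s" by (rule sigma_ring_hom) fact
  have xs: "x s \<in> carrier (A ?c)" "x s \<noteq> \<zero>\<^bsub>A ?c\<^esub>"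
    using skew_carrier_closed[OF xR sM] s by (auto simp: skew_support_def)
  have key: "a ?c \<otimes>\<^bsub>A ?c\<^esub> x s = x s \<otimes>\<^bsub>A ?c\<^esub> \<sigma> s (a ?d)"
    if a: "a \<in> coefficient_ring G A \<sigma>" for a
    using x a coefficient_mult_left[OF a xR sM] coefficient_mult_right[OF a xR sM]
    by (simp add: commutant_def)
  have dc: "?d = ?c"
  proof (rule ccontr)
    assume "?d \<noteq> ?c"
    then show False
      using key[OF monomial_in_coefficient_ring[OF c(1) B.one_closed]] c d xs
      by (simp add: monomial_def)
  qed
  have "\<sigma> s b = b" if b: "b \<in> carrier (A ?c)" for b
  proof -
    have sb: "\<sigma> s b \<in> carrier (A ?c)" using b dc by (metis h.hom_closed)
    have "b \<otimes>\<^bsub>A ?c\<^esub> x s = x s \<otimes>\<^bsub>A ?c\<^esub> \<sigma> s b"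
      using key[OF monomial_in_coefficient_ring[OF c(1) b]] c dc by (simp add: monomial_def)
    then have "x s \<otimes>\<^bsub>A ?c\<^esub> \<sigma> s b = x s \<otimes>\<^bsub>A ?c\<^esub> b"
      using B.m_comm[OF b xs(1)] by simp
    then show ?thesis using B.m_lcancel[OF xs(2,1) sb b] by simp
  qed
  then show ?thesis using dc c by (simp add: same_action_def sigma_id)
qed

section \<open>The equivalence\<close>

text \<open>
  If an element commuting with \<open>A\<close> had a morphism other than an identity in its support, the class kernel
  would be a nonzero ideal meeting \<open>A\<close> trivially.
\<close>

theorem maximal_commutative_iff_ideal_intersection:
  assumes fin: "finite (Ob G)" and dom: "\<And>e. e \<in> Ob G \<Longrightarrow> domain (A e)"
  shows "maximal_commutative R (coefficient_ring G A \<sigma>) \<longleftrightarrow>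
    (\<forall>I. ideal I R \<and> I \<noteq> {\<zero>\<^bsub>R\<^esub>} \<longrightarrow> I \<inter> coefficient_ring G A \<sigma> \<noteq> {\<zero>\<^bsub>R\<^esub>})"
    (is "?max \<longleftrightarrow> ?meets")
proof
  have comm: "cring (A e)" if "e \<in> Ob G" for e using dom[OF that] by (rule domain.axioms)
  show ?meets if ?max
    using that ideal_meets_coefficient_ring[OF comm] by (auto simp: maximal_commutative_def)
  show ?max if meets: ?meets
  proof -
    have ab: "\<forall>x\<in>coefficient_ring G A \<sigma>. \<forall>y\<in>coefficient_ring G A \<sigma>. x \<otimes>\<^bsub>R\<^esub> y = y \<otimes>\<^bsub>R\<^esub> x"
      using coefficient_commutes[OF comm] by blast
    have "x \<in> coefficient_ring G A \<sigma>" if x: "x \<in> commutant R (coefficient_ring G A \<sigma>)" for x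
    proof (rule ccontr)
      assume "x \<notin> coefficient_ring G A \<sigma>"
      then obtain s where s: "s \<in> supp x" "s \<notin> Ob G"
        using x by (auto simp: commutant_def coefficient_ring_def)
      have sM: "s \<in> Mor G" using s supp_subset_Mor by auto
      have c: "Cod G s \<in> Ob G" using cod_ob[OF sM] .
      have "class_kernel \<noteq> {\<zero>\<^bsub>R\<^esub>}"
        using class_kernel_nonzero[OF sM s(2) c commutant_supp_same_action[OF dom x s(1)]]
          domain.one_not_zero[OF dom[OF c]] by blast
      then have ne: "class_kernel \<inter> coefficient_ring G A \<sigma> \<noteq> {\<zero>\<^bsub>R\<^esub>}"
        using meets class_kernel_ideal[OF fin] by blast
      interpret K: ideal class_kernel R by (rule class_kernel_ideal) fact
      have "\<zero>\<^bsub>R\<^esub> \<in> class_kernel \<inter> coefficient_ring G A \<sigma>"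
        by (auto simp: coefficient_ring_def skew_support_def skew_zero_apply)
      then show False using ne class_kernel_Int_coefficient_ring by blast
    qed
    moreover have "coefficient_ring G A \<sigma> \<subseteq> commutant R (coefficient_ring G A \<sigma>)"
      using ab coefficient_ring_supp(1) by (auto simp: commutant_def)
    ultimately show ?max using ab by (auto simp: maximal_commutative_def)
  qed
qed

end

theorem corollary6:
  fixes G :: "'g category" and A :: "'g \<Rightarrow> ('a, 'm) ring_scheme" and \<sigma> :: "'g \<Rightarrow> 'a \<Rightarrow> 'a"
    and D :: "('a, 'm) ring_scheme"
  assumes "skew_groupoid_system G A \<sigma>"
    and "finite (Ob G)"
    and "domain D"
    and "\<And>e. e \<in> Ob G \<Longrightarrow> A e = D"
    and "\<And>e. e \<in> Ob G \<Longrightarrow> comm_group (isotropy G e)"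
  shows "maximal_commutative (skew_ring G A \<sigma>) (coefficient_ring G A \<sigma>) \<longleftrightarrow>
    (\<forall>I. ideal I (skew_ring G A \<sigma>) \<and> I \<noteq> {\<zero>\<^bsub>skew_ring G A \<sigma>\<^esub>} \<longrightarrow>
      I \<inter> coefficient_ring G A \<sigma> \<noteq> {\<zero>\<^bsub>skew_ring G A \<sigma>\<^esub>})"
proof -
  interpret skew_groupoid_system G A \<sigma> by fact
  show ?thesis
    using assms(2-4) by (intro maximal_commutative_iff_ideal_intersection) auto
qed

end
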